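(* Let $X$ be a separated locally convex topological vector space. Let $m\in\mathbb{N}$, and let $f_i:X\to\left]-\infty,+\infty\right]$ be proper and convex for each $i\in\{1,2,\ldots,m\}$, with $\bigcap_{i=1}^{m}\operatorname{dom} f_i\neq\varnothing$. Suppose that, for every $i\in\{1,\ldots,m\}$, $\overline{f_i}=f_i$ on $\bigcap_{j=1}^{m}\operatorname{dom}\overline{f_j}$. Then the following four conditions are equivalent. (i) There exists $K>0$ such that for every $x\in \bigcap_{i=1}^{m}\operatorname{dom} f_i$ and every $\varepsilon>0$, $$\overline{\left[\sum_{i=1}^{m}\partial_\varepsilon f_i(x)\right]}^{\mathrm{w*}}\subseteq\sum_{i=1}^{m}\partial_{K\varepsilon} f_i(x).$$ (ii) $\left(\sum_{i=1}^m f_i\right)^*=f_1^*\Box\cdots \Box f_m^*$ in $X^*$. (iii) $f_1^*\Box\cdots \Box f_m^*$ is weak$^*$ lower semicontinuous. (iv) For every $x\in X$ and every $\varepsilon\geq0$, $$\partial_{\varepsilon}(f_1+\cdots+f_m)(x)= \bigcap_{\eta>0} \left[ \bigcup_{\varepsilon_i\geq0,\ \sum_{i=1}^m\varepsilon_i=\varepsilon+\eta}\Big(\partial_{\varepsilon_1} f_1(x)+\cdots+\partial_{\varepsilon_m} f_m(x)\Big)\right].$$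
   Context: $X$ is a separated (Hausdorff) locally convex topological vector space and $X^*$ is its continuous dual endowed with the weak$^*$ topology $\omega(X^*,X)$; $\overline{D}^{\mathrm{w*}}$ is the weak$^*$ closure of $D\subseteq X^*$. Sums of sets are Minkowski sums. For $f:X\to[-\infty,+\infty]$: $\operatorname{dom} f=\{x: f(x)<+\infty\}$; $f$ is proper if $\operatorname{dom} f\neq\varnothing$ and $f>-\infty$ everywhere; $\overline{f}$ is the lower semicontinuous hull of $f$ (it may take the value $-\infty$); the Fenchel conjugate is $f^*:X^*\to[-\infty,+\infty]$, $f^*(x^* )=\sup_{x\in X}\{\langle x,x^*\rangle-f(x)\}$. For $\varepsilon\ge0$, the $\varepsilon$-subdifferential is $\partial_\varepsilon f(x)=\{x^*\in X^*: \langle y-x,x^*\rangle+f(x)\le f(y)+\varepsilon\ \ \forall y\in X\}$ if $f(x)\in\mathbb{R}$, and $\partial_\varepsilon f(x)=\varnothing$ otherwise. For functions $\psi_1,\ldots,\psi_m$ from $X^*$ to $[-\infty,+\infty]$, the infimal convolution is $(\psi_1\Box\cdots\Box\psi_m)(z)=\inf\{\psi_1(z_1)+\cdots+\psi_m(z_m): z_1+\cdots+z_m=z\}$. *)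

theory Defs
  imports "HOL-Analysis.Analysis" "HOL-Library.Set_Algebras"
begin

class topological_vector_space = real_vector + topological_ab_group_add +
  assumes tendsto_scaleR_Pair:
    "LIM p (nhds c \<times>\<^sub>F nhds x). fst p *\<^sub>R snd p :> nhds (c *\<^sub>R x)"

text \<open>The Hausdorff property is not part of the class; it is added with the sort \<open>t2_space\<close>.
  Convexity is spelled out because \<^const>\<open>convex\<close> is not available in a class specification;
  see \<open>convex_nhd_basis\<close> below.\<close>

class locally_convex_space = topological_vector_space +
  assumes locally_convex:
    "open U \<Longrightarrow> 0 \<in> U \<Longrightarrow>
     \<exists>V. open V \<and> 0 \<in> V \<and> V \<subseteq> U \<and>
       (\<forall>x\<in>V. \<forall>y\<in>V. \<forall>u\<ge>0. \<forall>v\<ge>0. u + v = 1 \<longrightarrow> u *\<^sub>R x + v *\<^sub>R y \<in> V)"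

lemma convex_nhd_basis:
  fixes U :: "'a::locally_convex_space set"
  assumes "open U" "0 \<in> U"
  obtains V where "open V" "convex V" "0 \<in> V" "V \<subseteq> U"
  using locally_convex[OF assms] unfolding convex_def by blast

typedef (overloaded) ('a::"{real_vector, topological_space}") dual =
    "{\<phi> :: 'a \<Rightarrow> real. linear \<phi> \<and> continuous_on UNIV \<phi>}"
  morphisms dual_apply Dual
  by (rule exI[of _ "\<lambda>_. 0"]) (auto simp: linear_iff)

setup_lifting type_definition_dual

instantiation dual :: ("{real_vector, topological_space}") real_vector
begin

lift_definition zero_dual :: "'a dual" is "\<lambda>_. 0"
  by (auto simp: linear_iff)

lift_definition plus_dual :: "'a dual \<Rightarrow> 'a dual \<Rightarrow> 'a dual" is "\<lambda>\<phi> \<psi> x. \<phi> x + \<psi> x"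
  by (auto intro: linear_compose_add continuous_on_add)

lift_definition minus_dual :: "'a dual \<Rightarrow> 'a dual \<Rightarrow> 'a dual" is "\<lambda>\<phi> \<psi> x. \<phi> x - \<psi> x"
  by (auto intro: linear_compose_sub continuous_on_diff)

lift_definition uminus_dual :: "'a dual \<Rightarrow> 'a dual" is "\<lambda>\<phi> x. - \<phi> x"
  by (auto intro: linear_compose_neg continuous_on_minus)

lift_definition scaleR_dual :: "real \<Rightarrow> 'a dual \<Rightarrow> 'a dual" is "\<lambda>c \<phi> x. c * \<phi> x"
  by (auto simp: linear_iff algebra_simps intro: continuous_on_mult_left)

instance
  by standard (transfer; auto simp: algebra_simps)+

end

text \<open>The topology on the dual is the weak* topology: the coarsest one that makes all evaluations
  \<open>\<lambda>\<phi>. dual_apply \<phi> x\<close> continuous.\<close>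

instantiation dual :: ("{real_vector, topological_space}") topological_space
begin

definition open_dual :: "'a dual set \<Rightarrow> bool" where
  "open_dual = generate_topology
     {(\<lambda>\<phi>. dual_apply \<phi> x) -` V |x V. open V}"

instance
proof -
  interpret dual: topological_space "open :: 'a dual set \<Rightarrow> bool"
    unfolding open_dual_def by (rule topological_space_generate_topology)
  show "OFCLASS('a dual, topological_space_class)"
    by standard (auto intro: dual.open_Union)
qed

end

definition effective_dom :: "('a \<Rightarrow> ereal) \<Rightarrow> 'a set" where
  "effective_dom f = {x. f x < \<infinity>}"

definition proper :: "('a \<Rightarrow> ereal) \<Rightarrow> bool" where
  "proper f \<longleftrightarrow> effective_dom f \<noteq> {} \<and> (\<forall>x. - \<infinity> < f x)"

text \<open>Only meaningful for functions that do not take the value \<open>- \<infinity>\<close>, since \<open>\<infinity> + - \<infinity> = \<infinity>\<close> in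
  \<^typ>\<open>ereal\<close>.\<close>

definition convex_fun :: "('a::real_vector \<Rightarrow> ereal) \<Rightarrow> bool" where
  "convex_fun f \<longleftrightarrow> (\<forall>x y. \<forall>t\<in>{0<..<1::real}.
     f ((1 - t) *\<^sub>R x + t *\<^sub>R y) \<le> ereal (1 - t) * f x + ereal t * f y)"

definition lsc :: "('a::topological_space \<Rightarrow> ereal) \<Rightarrow> bool" where
  "lsc f \<longleftrightarrow> (\<forall>a. open {x. a < f x})"

definition lsc_hull :: "('a::topological_space \<Rightarrow> ereal) \<Rightarrow> 'a \<Rightarrow> ereal" where
  "lsc_hull f x = (SUP g\<in>{g. lsc g \<and> (\<forall>y. g y \<le> f y)}. g x)"

definition conjugate ::
    "('a::{real_vector, topological_space} \<Rightarrow> ereal) \<Rightarrow> 'a dual \<Rightarrow> ereal" where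
  "conjugate f \<phi> = (SUP x. ereal (dual_apply \<phi> x) - f x)"

definition eps_subdiff ::
    "real \<Rightarrow> ('a::{real_vector, topological_space} \<Rightarrow> ereal) \<Rightarrow> 'a \<Rightarrow> 'a dual set" where
  "eps_subdiff \<epsilon> f x =
     (if \<bar>f x\<bar> \<noteq> \<infinity>
      then {\<phi>. \<forall>y. ereal (dual_apply \<phi> (y - x)) + f x \<le> f y + ereal \<epsilon>}
      else {})"

text \<open>The summands are conjugates of proper functions when this is used, so that \<open>\<infinity> + - \<infinity>\<close> does
  not arise.\<close>

definition inf_conv ::
    "'i set \<Rightarrow> ('i \<Rightarrow> 'b::comm_monoid_add \<Rightarrow> ereal) \<Rightarrow> 'b \<Rightarrow> ereal" where
  "inf_conv I \<psi> z = (INF w\<in>{w. (\<Sum>i\<in>I. w i) = z}. \<Sum>i\<in>I. \<psi> i (w i))"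

end

theory Submission
  imports Defs
begin

text \<open>Write \<open>g\<close> for the sum of the \<open>f\<^sub>i\<close> and \<open>h\<close> for the infimal convolution of their conjugates;
  always \<open>g* \<le> h\<close>. By the Fenchel--Moreau theorem in \<open>X\<close>, the conjugate of \<open>h\<close> on \<open>X\<close> is the sum of
  the hulls of the \<open>f\<^sub>i\<close>, which is \<open>g\<close> by hypothesis; by the same theorem in the weak* dual, \<open>g*\<close> is
  the weak* lower semicontinuous hull of \<open>h\<close>. Hence (ii) and (iii) are equivalent. At a point \<open>x\<close>
  of the common domain, the two sides of (iv) are \<open>{\<phi>. g* \<phi> \<le> \<phi> x - g x + \<epsilon>}\<close> and
  \<open>{\<phi>. h \<phi> \<le> \<phi> x - g x + \<epsilon>}\<close>, so (iv) is equivalent to \<open>g* = h\<close>. For (i) implies (ii), pick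
  \<open>x\<close> that attains \<open>g* \<phi>\<close> up to \<open>\<epsilon>\<close>. Since \<open>(\<phi>, g* \<phi>)\<close> is in the closure of the epigraph of \<open>h\<close>,
  \<open>\<phi>\<close> is in the closure of the sum of the \<open>3\<epsilon>\<close>-subdifferentials at \<open>x\<close>, and (i) yields
  \<open>h \<phi> \<le> g* \<phi> + 3mK\<epsilon>\<close>. Conversely the sum of the \<open>\<epsilon>\<close>-subdifferentials of the \<open>f\<^sub>i\<close> lies in the closed
  set \<open>\<partial>\<^bsub>m\<epsilon>\<^esub> g x\<close>, and \<open>K = m + 1\<close> works if \<open>g* = h\<close>.\<close>

subsection \<open>Hahn--Banach and affine minorants\<close>

definition sublinear :: "('a::real_vector \<Rightarrow> real) \<Rightarrow> bool" where
  "sublinear p \<longleftrightarrow> (\<forall>x y. p (x + y) \<le> p x + p y) \<and> (\<forall>c>0. \<forall>x. p (c *\<^sub>R x) = c * p x)"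

lemma sublinear_add: "sublinear p \<Longrightarrow> p (x + y) \<le> p x + p y"
  and sublinear_scale_pos: "sublinear p \<Longrightarrow> c > 0 \<Longrightarrow> p (c *\<^sub>R x) = c * p x"
  by (auto simp: sublinear_def)

lemma sublinear_zero: "sublinear p \<Longrightarrow> p 0 = 0"
  using sublinear_scale_pos[of p 2 0] by simp

lemma sublinear_scale: "sublinear p \<Longrightarrow> c \<ge> 0 \<Longrightarrow> p (c *\<^sub>R x) = c * p x"
  by (cases "c = 0") (auto simp: sublinear_zero sublinear_scale_pos)

lemma sublinear_minus: "sublinear p \<Longrightarrow> - p (- x) \<le> p x"
  using sublinear_add[of p x "- x"] sublinear_zero[of p] by simp

lemma sublinear_cmult: "sublinear p \<Longrightarrow> c \<ge> 0 \<Longrightarrow> sublinear (\<lambda>x. c * p x)"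
  by (auto simp: sublinear_def distrib_left[symmetric] intro!: mult_left_mono)

text \<open>Subadditivity comes from taking infima in \<open>add\<close> over \<open>a\<close> and
  then over \<open>b\<close>. The memberships in \<open>scale\<close> give one inequality for
  \<open>c\<close> and, applied to \<open>inverse c\<close>, the other. Perturbations along a
  vector, chains, the sandwich and the gauge all use infima of this shape.\<close>

lemma sublinear_Inf:
  fixes R :: "'a::real_vector \<Rightarrow> real set"
  assumes ne: "\<And>x. R x \<noteq> {}" and bdd: "\<And>x. bdd_below (R x)"
    and add: "\<And>x y a b. a \<in> R x \<Longrightarrow> b \<in> R y \<Longrightarrow> \<exists>c\<in>R (x + y). c \<le> a + b"
    and scale: "\<And>x a c. a \<in> R x \<Longrightarrow> c > 0 \<Longrightarrow> c * a \<in> R (c *\<^sub>R x)"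
  shows "sublinear (\<lambda>x. Inf (R x))"
  unfolding sublinear_def
proof (intro conjI allI impI)
  fix x y
  have "Inf (R (x + y)) - b \<le> a" if "a \<in> R x" "b \<in> R y" for a b
    using add[OF that] cInf_lower[OF _ bdd, of _ "x + y"] by fastforce
  then have "Inf (R (x + y)) - b \<le> Inf (R x)" if "b \<in> R y" for b
    using that by (intro cInf_greatest[OF ne]) auto
  then have "Inf (R (x + y)) - Inf (R x) \<le> Inf (R y)"
    by (intro cInf_greatest[OF ne]) (force simp: algebra_simps)
  then show "Inf (R (x + y)) \<le> Inf (R x) + Inf (R y)" by simp
next
  have le: "Inf (R (c *\<^sub>R x)) \<le> c * Inf (R x)" if "c > 0" for c :: real and x
  proof -
    have "Inf (R (c *\<^sub>R x)) / c \<le> a" if "a \<in> R x" for a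
      using cInf_lower[OF scale[OF that \<open>c > 0\<close>] bdd] \<open>c > 0\<close> by (simp add: field_simps)
    then have "Inf (R (c *\<^sub>R x)) / c \<le> Inf (R x)" by (intro cInf_greatest[OF ne])
    then show ?thesis using that by (simp add: field_simps)
  qed
  fix c :: real and x assume "c > 0"
  then show "Inf (R (c *\<^sub>R x)) = c * Inf (R x)"
    using le[of c x] le[of "inverse c" "c *\<^sub>R x"] by (simp add: field_simps)
qed

text \<open>A sublinear function that is minimal below \<open>p\<close> is additive: otherwise, for some \<open>v\<close>,
  \<open>x \<mapsto> inf\<^sub>t (p (x + t v) - t p v)\<close> would be strictly smaller.\<close>

lemma minimal_sublinear_linear:
  fixes p :: "'a::real_vector \<Rightarrow> real"
  assumes p: "sublinear p"
    and minimal: "\<And>p'. sublinear p' \<Longrightarrow> (\<And>x. p' x \<le> p x) \<Longrightarrow> p' = p"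
  shows "linear p"
proof -
  have add_le: "p x + p v \<le> p (x + v)" for x v
  proof -
    define R where "R = (\<lambda>x. {p (x + t *\<^sub>R v) - t * p v |t. t \<ge> 0})"
    \<comment> \<open>Writing t v as (x + t v) + (-x) bounds \<open>R x\<close> from below, so its
      infimum is a genuine real infimum.\<close>
    have lower: "- p (- x) \<le> p (x + t *\<^sub>R v) - t * p v" if "t \<ge> 0" for x t
      using sublinear_add[OF p, of "x + t *\<^sub>R v" "- x"] sublinear_scale[OF p that, of v] by simp
    have bdd: "bdd_below (R x)" for x
      using lower by (auto simp: R_def bdd_below_def)
    have mem: "p (x + t *\<^sub>R v) - t * p v \<in> R x" if "t \<ge> 0" for x t
      using that by (auto simp: R_def)
    have "sublinear (\<lambda>x. Inf (R x))"
    proof (rule sublinear_Inf[OF _ bdd])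
      show "R x \<noteq> {}" for x using mem[of 0] by blast
      fix x y a b assume "a \<in> R x" "b \<in> R y"
      then obtain s t where st: "s \<ge> 0" "t \<ge> 0"
        "a = p (x + s *\<^sub>R v) - s * p v" "b = p (y + t *\<^sub>R v) - t * p v"
        by (auto simp: R_def)
      have "p (x + y + (s + t) *\<^sub>R v) - (s + t) * p v \<le> a + b"
        using sublinear_add[OF p, of "x + s *\<^sub>R v" "y + t *\<^sub>R v"] st
        by (simp add: algebra_simps)
      with st(1,2) show "\<exists>c\<in>R (x + y). c \<le> a + b"
        by (intro bexI[OF _ mem[of "s + t"]]) auto
    next
      fix x a and c :: real assume "a \<in> R x" "c > 0"
      then obtain s where s: "s \<ge> 0" "a = p (x + s *\<^sub>R v) - s * p v" by (auto simp: R_def)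
      have "c * a = p (c *\<^sub>R x + (c * s) *\<^sub>R v) - (c * s) * p v"
        unfolding s(2) right_diff_distrib sublinear_scale_pos[OF p \<open>c > 0\<close>, symmetric]
        by (simp add: scaleR_add_right)
      then show "c * a \<in> R (c *\<^sub>R x)" using mem[of "c * s" "c *\<^sub>R x"] s \<open>c > 0\<close> by simp
    qed
    moreover have "Inf (R x) \<le> p x" for x
      using cInf_lower[OF mem[of 0 x] bdd] by simp
    ultimately have "(\<lambda>x. Inf (R x)) = p" by (rule minimal)
    \<comment> \<open>By minimality the infimum is \<open>p x\<close> itself; comparison with its
      entry at t = 1 reverses subadditivity.\<close>
    then have "p x = Inf (R x)" by metis
    also have "\<dots> \<le> p (x + v) - p v" using cInf_lower[OF mem[of 1 x] bdd] by simp
    finally show ?thesis by simp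
  qed
  have add: "p (x + y) = p x + p y" for x y
    using add_le[of x y] sublinear_add[OF p, of x y] by simp
  have neg: "p (- x) = - p x" for x using add[of x "- x"] sublinear_zero[OF p] by simp
  have "p (c *\<^sub>R x) = c * p x" for c x
  proof (cases "c \<ge> 0")
    case False
    then show ?thesis using sublinear_scale[OF p, of "- c" x] neg[of "c *\<^sub>R x"] by simp
  qed (rule sublinear_scale[OF p])
  then show ?thesis using add by (intro linearI) auto
qed

text \<open>Zorn's lemma gives a minimal sublinear function below \<open>p\<close>, which is linear
  by \<open>minimal_sublinear_linear\<close>. A chain has a lower bound because its pointwise
  infimum is again sublinear.\<close>

lemma hahn_banach:
  fixes p :: "'a::real_vector \<Rightarrow> real"
  assumes p: "sublinear p"
  obtains l where "linear l" "\<And>x. l x \<le> p x"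
proof -
  define A where "A = {q. sublinear q \<and> (\<forall>x. q x \<le> p x)}"
  have "\<exists>m\<in>A. \<forall>a\<in>A. m \<ge> a \<longrightarrow> a = m"
  proof (rule predicate_Zorn)
    show "partial_order_on A (relation_of (\<ge>) A)"
      by (auto simp: order_on_defs relation_of_def refl_on_def trans_def antisym_def)
    fix C assume C: "C \<in> Chains (relation_of (\<ge>) A)"
    have CA: "C \<subseteq> A" using C by (auto simp: Chains_def relation_of_def)
    have tot: "q \<le> q' \<or> q' \<le> q" if "q \<in> C" "q' \<in> C" for q q'
      using C that by (auto simp: Chains_def relation_of_def)
    show "\<exists>u\<in>A. \<forall>a\<in>C. u \<le> a"
    proof (cases "C = {}")
      case True
      then show ?thesis using p by (auto simp: A_def)
    next
      case False
      define R where "R = (\<lambda>x. (\<lambda>q. q x) ` C)"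
      \<comment> \<open>Each member satisfies - p (-x) <= - q (-x) <= q x, a bound independent of
        \<open>q\<close> that keeps the infimum finite.\<close>
      have "- p (- x) \<le> q x" if "q \<in> C" for q x
      proof -
        have "q \<in> A" using that CA by blast
        then have "sublinear q" "q (- x) \<le> p (- x)" by (auto simp: A_def)
        then show ?thesis using sublinear_minus[of q x] by simp
      qed
      then have bdd: "bdd_below (R x)" for x by (auto simp: R_def bdd_below_def)
      have "sublinear (\<lambda>x. Inf (R x))"
      proof (rule sublinear_Inf[OF _ bdd])
        show "R x \<noteq> {}" for x using False by (simp add: R_def)
        fix x y a b assume "a \<in> R x" "b \<in> R y"
        then obtain q q' where q: "q \<in> C" "q' \<in> C" "a = q x" "b = q' y" by (auto simp: R_def)
        \<comment> \<open>Members of a chain are comparable, so \<open>inf q q'\<close> is one of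
          the two and stays in \<open>C\<close>.\<close>
        define r where "r = inf q q'"
        have r: "r \<in> C" "r \<le> q" "r \<le> q'"
          using tot[OF q(1,2)] q by (auto simp: r_def inf_absorb1 inf_absorb2)
        have "sublinear r" using r(1) CA by (auto simp: A_def)
        then have "r (x + y) \<le> r x + r y" by (rule sublinear_add)
        also have "\<dots> \<le> a + b" using r q by (auto simp: le_fun_def intro: add_mono)
        finally show "\<exists>c\<in>R (x + y). c \<le> a + b" using r(1) by (auto simp: R_def)
      next
        fix x a and c :: real assume "a \<in> R x" "c > 0"
        then obtain q where q: "q \<in> C" "a = q x" by (auto simp: R_def)
        then have "c * a = q (c *\<^sub>R x)"
          using CA sublinear_scale_pos[of q c x] \<open>c > 0\<close> by (auto simp: A_def)
        then show "c * a \<in> R (c *\<^sub>R x)" using q by (auto simp: R_def)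
      qed
      moreover have le: "Inf (R x) \<le> q x" if "q \<in> C" for q x
        using that by (intro cInf_lower[OF _ bdd]) (auto simp: R_def)
      moreover have "Inf (R x) \<le> p x" for x
        using False le CA by (force simp: A_def intro: order_trans)
      ultimately show ?thesis
        by (intro bexI[of _ "\<lambda>x. Inf (R x)"]) (auto simp: A_def le_fun_def)
    qed
  qed
  then obtain m where m: "sublinear m" "\<And>x. m x \<le> p x"
    and min: "\<And>a. sublinear a \<Longrightarrow> (\<forall>x. a x \<le> p x) \<Longrightarrow> a \<le> m \<Longrightarrow> a = m"
    by (auto simp: A_def)
  have "linear m"
  proof (rule minimal_sublinear_linear[OF m(1)])
    fix q assume "sublinear q" "\<And>x. q x \<le> m x"
    then show "q = m" using m(2) by (intro min) (auto simp: le_fun_def intro: order_trans)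
  qed
  with m(2) that show thesis by blast
qed

text \<open>The linear form is found below the sublinear hull
  \<open>v \<mapsto> inf {t (s - r) + q (v - t (u - x\<^sub>0)) | t \<ge> 0, (u, s) \<in> C}\<close> of \<open>q\<close> and the convex function
  with epigraph \<open>C\<close>.\<close>

lemma convex_sublinear_sandwich:
  fixes C :: "('a::real_vector \<times> real) set"
  assumes C: "convex C" and q: "sublinear q" and even: "\<And>x. q (- x) = q x"
    and le: "\<And>u s. (u, s) \<in> C \<Longrightarrow> r \<le> s + q (u - x\<^sub>0)"
  obtains l where "linear l" "\<And>x. l x \<le> q x" "\<And>u s. (u, s) \<in> C \<Longrightarrow> r + l (u - x\<^sub>0) \<le> s"
proof -
  \<comment> \<open>For t = 0 the pair \<open>(u, s)\<close> is arbitrary and drops out, so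
    \<open>q v\<close> lies in \<open>R v\<close> even if \<open>C\<close> is empty.\<close>
  define R where "R = (\<lambda>v. {t * (s - r) + q (v - t *\<^sub>R (u - x\<^sub>0)) |t u s.
    t \<ge> 0 \<and> (t = 0 \<or> (u, s) \<in> C)})"
  have mem: "t * (s - r) + q (v - t *\<^sub>R (u - x\<^sub>0)) \<in> R v"
    if "t \<ge> 0" "t = 0 \<or> (u, s) \<in> C" for t u s v
    using that by (auto simp: R_def)
  have q_mem: "q v \<in> R v" for v using mem[of 0] by simp
  have lower: "- q v \<le> a" if "a \<in> R v" for a v
  proof -
    from that obtain t u s where t: "t \<ge> 0" "t = 0 \<or> (u, s) \<in> C"
      and a: "a = t * (s - r) + q (v - t *\<^sub>R (u - x\<^sub>0))"
      unfolding R_def by blast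
    have "0 \<le> t * (s - r + q (u - x\<^sub>0))" using t le[of u s] by auto
    also have "\<dots> = t * (s - r) + q (t *\<^sub>R (u - x\<^sub>0))"
      using sublinear_scale[OF q t(1)] by (simp add: distrib_left)
    finally have "0 \<le> t * (s - r) + q (t *\<^sub>R (u - x\<^sub>0))" .
    \<comment> \<open>Evenness of \<open>q\<close> enters here: the triangle inequality is applied
      to \<open>v\<close> and the negative of v - t (u - x0).\<close>
    moreover have "q (t *\<^sub>R (u - x\<^sub>0)) \<le> q v + q (v - t *\<^sub>R (u - x\<^sub>0))"
      using sublinear_add[OF q, of v "- (v - t *\<^sub>R (u - x\<^sub>0))"] by (simp only: even) simp
    ultimately show ?thesis using a by simp
  qed
  then have bdd: "bdd_below (R v)" for v by (auto simp: bdd_below_def)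
  have "sublinear (\<lambda>v. Inf (R v))"
  proof (rule sublinear_Inf[OF _ bdd])
    show "R x \<noteq> {}" for x using q_mem by blast
    fix x y a b assume "a \<in> R x" "b \<in> R y"
    from \<open>a \<in> R x\<close> obtain t u s where
      t: "t \<ge> 0" "t = 0 \<or> (u, s) \<in> C" "a = t * (s - r) + q (x - t *\<^sub>R (u - x\<^sub>0))"
      unfolding R_def by blast
    from \<open>b \<in> R y\<close> obtain t' u' s' where
      t': "t' \<ge> 0" "t' = 0 \<or> (u', s') \<in> C" "b = t' * (s' - r) + q (y - t' *\<^sub>R (u' - x\<^sub>0))"
      unfolding R_def by blast
    \<comment> \<open>Two entries add up to one with weight t + t' at a convex combination of their
      points. Zero weights are split off because their points need not lie in
      \<open>C\<close>.\<close>
    have "\<exists>u'' s''. (t + t' = 0 \<or> (u'', s'') \<in> C) \<and> (t + t') *\<^sub>R u'' = t *\<^sub>R u + t' *\<^sub>R u'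
        \<and> (t + t') * s'' = t * s + t' * s'"
    proof -
      consider "t = 0" | "t' = 0" | "t \<noteq> 0" "t' \<noteq> 0" by blast
      then show ?thesis
      proof cases
        case 1
        then show ?thesis using t'(2) by (intro exI[of _ u'] exI[of _ s']) auto
      next
        case 2
        then show ?thesis using t(2) by (intro exI[of _ u] exI[of _ s]) auto
      next
        case 3
        then have pos: "t > 0" "t' > 0" and mem: "(u, s) \<in> C" "(u', s') \<in> C"
          using t t' by auto
        have "(t / (t + t')) *\<^sub>R (u, s) + (t' / (t + t')) *\<^sub>R (u', s') \<in> C"
          using pos by (intro convexD[OF C mem]) (auto simp: add_divide_distrib[symmetric])
        then have "((t / (t + t')) *\<^sub>R u + (t' / (t + t')) *\<^sub>R u',
            (t / (t + t')) * s + (t' / (t + t')) * s') \<in> C"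
          by simp
        then show ?thesis
          using pos
          by (intro exI[of _ "(t / (t + t')) *\<^sub>R u + (t' / (t + t')) *\<^sub>R u'"]
              exI[of _ "(t / (t + t')) * s + (t' / (t + t')) * s'"])
            (auto simp: scaleR_add_right distrib_left)
      qed
    qed
    then obtain u'' s'' where u'': "t + t' = 0 \<or> (u'', s'') \<in> C"
      "(t + t') *\<^sub>R u'' = t *\<^sub>R u + t' *\<^sub>R u'" "(t + t') * s'' = t * s + t' * s'"
      by blast
    have eq: "x + y - (t + t') *\<^sub>R (u'' - x\<^sub>0)
        = (x - t *\<^sub>R (u - x\<^sub>0)) + (y - t' *\<^sub>R (u' - x\<^sub>0))"
      using u''(2) by (simp add: scaleR_diff_right scaleR_add_left)
    have "(t + t') * (s'' - r) + q (x + y - (t + t') *\<^sub>R (u'' - x\<^sub>0))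
        \<le> a + b"
      using sublinear_add[OF q, of "x - t *\<^sub>R (u - x\<^sub>0)" "y - t' *\<^sub>R (u' - x\<^sub>0)"] u''(3)
      unfolding eq t(3) t'(3) by (simp add: algebra_simps)
    with u''(1) t(1) t'(1) show "\<exists>c\<in>R (x + y). c \<le> a + b"
      by (intro bexI[OF _ mem[of "t + t'" u'' s'']]) auto
  next
    fix x a and c :: real assume "a \<in> R x" "c > 0"
    then obtain t u s where t: "t \<ge> 0" "t = 0 \<or> (u, s) \<in> C"
      "a = t * (s - r) + q (x - t *\<^sub>R (u - x\<^sub>0))"
      unfolding R_def by blast
    have "c * a = c * t * (s - r) + q (c *\<^sub>R (x - t *\<^sub>R (u - x\<^sub>0)))"
      unfolding t(3) distrib_left sublinear_scale_pos[OF q \<open>c > 0\<close>] by simp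
    then have "c * a = (c * t) * (s - r) + q (c *\<^sub>R x - (c * t) *\<^sub>R (u - x\<^sub>0))"
      by (simp add: scaleR_diff_right)
    then show "c * a \<in> R (c *\<^sub>R x)" using mem[of "c * t" u s "c *\<^sub>R x"] t \<open>c > 0\<close> by auto
  qed
  then obtain l where l: "linear l" "\<And>v. l v \<le> Inf (R v)" using hahn_banach by blast
  \<comment> \<open>The entry of \<open>R\<close> with t = 0 gives domination by \<open>q\<close>;
    the one with t = 1 at u - x0 gives the affine bound, as \<open>q 0 = 0\<close>.\<close>
  have "l v \<le> q v" for v using l(2)[of v] cInf_lower[OF q_mem bdd] by (rule order_trans)
  moreover have "r + l (u - x\<^sub>0) \<le> s" if "(u, s) \<in> C" for u s
    using l(2)[of "u - x\<^sub>0"] cInf_lower[OF mem[of 1 u s "u - x\<^sub>0"] bdd] that sublinear_zero[OF q]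
    by simp
  ultimately show thesis using that l(1) by blast
qed

section \<open>Gauges and continuity of linear forms\<close>

lemma tendsto_tvs_scaleR:
  fixes g :: "'b \<Rightarrow> 'a::topological_vector_space"
  assumes "(f \<longlongrightarrow> c) F" "(g \<longlongrightarrow> x) F"
  shows "((\<lambda>y. f y *\<^sub>R g y) \<longlongrightarrow> c *\<^sub>R x) F"
  using filterlim_compose[OF tendsto_scaleR_Pair filterlim_Pair[OF assms]] by simp

lemma open_translate_tvs:
  fixes U :: "'a::topological_vector_space set"
  assumes "open U"
  shows "open {v. x + v \<in> U}"
proof -
  have "continuous_on UNIV (\<lambda>v. x + v)" by (intro continuous_intros)
  then show ?thesis using open_vimage[OF assms, of "\<lambda>v. x + v"] by (simp add: vimage_def)
qed

text \<open>The gauge of a convex neighbourhood is sublinear; intersecting the neighbourhood with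
  its negative makes it even. The set \<open>V\<close>, on which the gauge is at most 1, later
  yields continuity of linear forms dominated by it.\<close>

lemma Minkowski_gauge:
  fixes U :: "'a::locally_convex_space set"
  assumes "open U" "0 \<in> U"
  obtains q V where "sublinear q" "\<And>x. q (- x) = q x" "\<And>x. 0 \<le> q x"
    "open V" "0 \<in> V" "\<And>x. x \<in> V \<Longrightarrow> q x \<le> 1" "\<And>x. q x < 1 \<Longrightarrow> x \<in> U"
proof -
  obtain W where W: "open W" "convex W" "0 \<in> W" "W \<subseteq> U" using convex_nhd_basis[OF assms] .
  define V where "V = W \<inter> uminus -` W"
  have "continuous_on UNIV (uminus :: 'a \<Rightarrow> 'a)" by (intro continuous_intros)
  then have V: "open V" "0 \<in> V" "V \<subseteq> U"
    using W open_vimage[OF W(1), of uminus] by (auto simp: V_def)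
  have convex: "a *\<^sub>R x + b *\<^sub>R y \<in> V" if "x \<in> V" "y \<in> V" "a \<ge> 0" "b \<ge> 0" "a + b = 1" for a b x y
    using convexD[OF W(2), of x y a b] convexD[OF W(2), of "- x" "- y" a b] that
    by (auto simp: V_def)
  have V_even: "- x \<in> V \<longleftrightarrow> x \<in> V" for x by (auto simp: V_def)
  define R where "R = (\<lambda>x. {t. t > 0 \<and> x /\<^sub>R t \<in> V})"
  define q where "q = (\<lambda>x. Inf (R x))"
  have bdd: "bdd_below (R x)" for x by (auto simp: R_def bdd_below_def intro: less_imp_le)
  have ne: "R x \<noteq> {}" for x
  proof -
    \<comment> \<open>Neighbourhoods of 0 are absorbing: t x tends to 0 as t decreases to 0.\<close>
    have "((\<lambda>t. t *\<^sub>R x) \<longlongrightarrow> 0 *\<^sub>R x) (at_right 0)" by (intro tendsto_tvs_scaleR tendsto_intros)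
    then have "\<forall>\<^sub>F t in at_right 0. t *\<^sub>R x \<in> V" using V by (auto dest: topological_tendstoD)
    moreover have "\<forall>\<^sub>F t in at_right 0. t > (0::real)" by (simp add: eventually_at_right_less)
    ultimately have "\<forall>\<^sub>F t in at_right 0. t *\<^sub>R x \<in> V \<and> t > 0" by (rule eventually_conj)
    then obtain t where "t > 0" "t *\<^sub>R x \<in> V"
      using eventually_happens'[OF trivial_limit_at_right_real] by blast
    then have "inverse t \<in> R x" by (simp add: R_def)
    then show ?thesis by blast
  qed
  have "sublinear q" unfolding q_def
  proof (rule sublinear_Inf[OF ne bdd])
    fix x y a b assume "a \<in> R x" "b \<in> R y"
    then have ab: "a > 0" "b > 0" "x /\<^sub>R a \<in> V" "y /\<^sub>R b \<in> V" by (auto simp: R_def)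
    then have "(a / (a + b)) *\<^sub>R (x /\<^sub>R a) + (b / (a + b)) *\<^sub>R (y /\<^sub>R b) \<in> V"
      by (intro convex) (auto simp: add_divide_distrib[symmetric])
    then have "(x + y) /\<^sub>R (a + b) \<in> V" using ab
      by (simp add: scaleR_add_right divide_inverse mult.commute mult.left_commute
          flip: mult.assoc)
    then show "\<exists>c\<in>R (x + y). c \<le> a + b" using ab by (intro bexI[of _ "a + b"]) (auto simp: R_def)
  next
    fix x a and c :: real assume "a \<in> R x" "c > 0"
    then show "c * a \<in> R (c *\<^sub>R x)" by (auto simp: R_def field_simps)
  qed
  moreover have "q (- x) = q x" for x by (simp add: q_def R_def V_even)
  moreover have "0 \<le> q x" for x unfolding q_def using ne by (intro cInf_greatest) (auto simp: R_def)
  moreover have "q x \<le> 1" if "x \<in> V" for x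
    unfolding q_def using that by (intro cInf_lower[OF _ bdd]) (auto simp: R_def)
  moreover have "x \<in> U" if "q x < 1" for x
  proof -
    have "Inf (R x) < 1" using that by (simp add: q_def)
    from cInf_lessD[OF ne this] obtain t where t: "t > 0" "x /\<^sub>R t \<in> V" "t < 1"
      by (auto simp: R_def)
    then have "t *\<^sub>R (x /\<^sub>R t) + (1 - t) *\<^sub>R 0 \<in> V" using V by (intro convex) auto
    then show ?thesis using t V by auto
  qed
  ultimately show thesis using that V by blast
qed

lemma dual_apply_linear: "linear (dual_apply \<phi>)"
  and dual_apply_continuous: "continuous_on UNIV (dual_apply \<phi>)"
  using dual_apply[of \<phi>] by auto

lemmas dual_apply_add = linear_add[OF dual_apply_linear]
  and dual_apply_diff = linear_diff[OF dual_apply_linear]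
  and dual_apply_scaleR = linear_scale[OF dual_apply_linear]
  and dual_apply_zero = linear_0[OF dual_apply_linear]

text \<open>A one-sided bound near 0 suffices: scaling by C / e and using both signs makes |l|
  smaller than e near 0, and linearity carries continuity at 0 to every point.\<close>

lemma dual_of_dominated_linear:
  fixes l :: "'a::topological_vector_space \<Rightarrow> real"
  assumes l: "linear l" and V: "open V" "0 \<in> V" and bound: "\<And>x. x \<in> V \<Longrightarrow> l x \<le> B"
  obtains \<phi> :: "'a dual" where "dual_apply \<phi> = l"
proof -
  \<comment> \<open>The added 1 makes \<open>C\<close> positive and strictly larger than
    \<open>B\<close>.\<close>
  define C where "C = \<bar>B\<bar> + 1"
  have C: "C > 0" by (simp add: C_def)
  have lim0: "(l \<longlongrightarrow> 0) (nhds 0)"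
  proof (rule tendstoI)
    fix e :: real assume e: "e > 0"
    have "((\<lambda>x. (C / e) *\<^sub>R x) \<longlongrightarrow> (C / e) *\<^sub>R 0) (nhds (0::'a))"
      "((\<lambda>x. - ((C / e) *\<^sub>R x)) \<longlongrightarrow> - ((C / e) *\<^sub>R 0)) (nhds (0::'a))"
      by (intro tendsto_minus tendsto_tvs_scaleR tendsto_ident_at filterlim_ident tendsto_const)+
    then have "\<forall>\<^sub>F x in nhds 0. (C / e) *\<^sub>R x \<in> V \<and> - ((C / e) *\<^sub>R x) \<in> V"
      using V by (auto intro!: eventually_conj dest: topological_tendstoD)
    then show "\<forall>\<^sub>F x in nhds 0. dist (l x) 0 < e"
    proof eventually_elim
      case (elim x)
      have "(C / e) * l x < C" "- ((C / e) * l x) < C"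
        using bound[of "(C / e) *\<^sub>R x"] bound[of "- ((C / e) *\<^sub>R x)"] elim
        by (auto simp: linear_scale[OF l] linear_neg[OF l] C_def)
      then have "C * l x < C * e" "C * (- l x) < C * e" using e by (auto simp: field_simps)
      then have "l x < e" "- l x < e" using C unfolding mult_less_cancel_left_pos[OF C] by auto
      then show ?case by (simp add: abs_less_iff)
    qed
  qed
  have "(l \<longlongrightarrow> l x) (at x)" for x
  proof -
    have "((\<lambda>y. y - x) \<longlongrightarrow> x - x) (at x)" by (intro tendsto_intros)
    then have "((\<lambda>y. l (y - x)) \<longlongrightarrow> 0) (at x)"
      using filterlim_compose[OF lim0] by simp
    then have "((\<lambda>y. l (y - x) + l x) \<longlongrightarrow> 0 + l x) (at x)" by (intro tendsto_intros)
    then show ?thesis by (simp add: linear_diff[OF l])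
  qed
  then have "continuous_on UNIV l" by (simp add: continuous_on_def)
  then show thesis using that[of "Dual l"] l by (simp add: Dual_inverse)
qed

text \<open>Reduces affine minorants to a lower bound by a multiple of a gauge: the sandwich with
  \<open>N * q\<close> gives a linear form bounded by \<open>N\<close> on \<open>V\<close>, hence
  continuous.\<close>

lemma affine_minorant_of_seminorm:
  fixes C :: "('a::topological_vector_space \<times> real) set"
  assumes "convex C" "sublinear q" "\<And>x. q (- x) = q x"
    and "open V" "0 \<in> V" "\<And>x. x \<in> V \<Longrightarrow> q x \<le> 1"
    and "N \<ge> 0" "\<And>u s. (u, s) \<in> C \<Longrightarrow> r \<le> s + N * q (u - x\<^sub>0)"
  obtains \<phi> :: "'a dual" where "\<And>u s. (u, s) \<in> C \<Longrightarrow> r + dual_apply \<phi> (u - x\<^sub>0) \<le> s"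
proof -
  obtain l where l: "linear l" "\<And>x. l x \<le> N * q x" "\<And>u s. (u, s) \<in> C \<Longrightarrow> r + l (u - x\<^sub>0) \<le> s"
    using convex_sublinear_sandwich[of C "\<lambda>x. N * q x" r x\<^sub>0] assms sublinear_cmult by metis
  have "l x \<le> N" if "x \<in> V" for x
    using l(2)[of x] mult_left_mono[OF assms(6)[OF that] assms(7)] by simp
  with l(3) that dual_of_dominated_linear[OF l(1) assms(4,5)] show thesis by metis
qed

text \<open>If \<open>u\<close> has gauge \<open>\<sigma> \<ge> 1\<close> relative to \<open>x\<^sub>1\<close>, comparing with the point at gauge \<open>1/2\<close>
  on the segment to \<open>u\<close> shows that \<open>C\<close> descends at most with slope \<open>2 (b - a)\<close>.\<close>

lemma convex_affine_minorant:
  fixes C :: "('a::locally_convex_space \<times> real) set"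
  assumes C: "convex C" "(x\<^sub>1, b) \<in> C" and U: "open U" "x\<^sub>1 \<in> U"
    and lower: "\<And>u s. (u, s) \<in> C \<Longrightarrow> u \<in> U \<Longrightarrow> a \<le> s"
  obtains \<phi> :: "'a dual" and c where "\<And>u s. (u, s) \<in> C \<Longrightarrow> dual_apply \<phi> u + c \<le> s"
proof -
  have ab: "a \<le> b" using lower C U by blast
  obtain q V where q: "sublinear q" "\<And>x. q (- x) = q x" "\<And>x. 0 \<le> q x"
    "open V" "0 \<in> V" "\<And>x. x \<in> V \<Longrightarrow> q x \<le> 1" "\<And>x. q x < 1 \<Longrightarrow> x \<in> {v. x\<^sub>1 + v \<in> U}"
    using Minkowski_gauge[OF open_translate_tvs[OF U(1), of x\<^sub>1]] U(2) by auto
  have "a \<le> s + 2 * (b - a) * q (u - x\<^sub>1)" if us: "(u, s) \<in> C" for u s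
  proof (cases "q (u - x\<^sub>1) < 1")
    case True
    then have "a \<le> s" using q(7)[of "u - x\<^sub>1"] lower[OF us] by simp
    then show ?thesis using ab q(3)[of "u - x\<^sub>1"] by (simp add: add_increasing2)
  next
    case False
    define \<sigma> where "\<sigma> = q (u - x\<^sub>1)"
    define t where "t = 1 / (2 * \<sigma>)"
    have \<sigma>: "\<sigma> \<ge> 1" using False by (simp add: \<sigma>_def)
    then have t: "t > 0" "t \<le> 1" by (auto simp: t_def)
    have "q (t *\<^sub>R (u - x\<^sub>1)) = 1 / 2"
      using sublinear_scale_pos[OF q(1) t(1)] \<sigma> by (simp add: \<sigma>_def[symmetric]) (simp add: t_def)
    then have U': "x\<^sub>1 + t *\<^sub>R (u - x\<^sub>1) \<in> U" using q(7)[of "t *\<^sub>R (u - x\<^sub>1)"] by simp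
    have "(1 - t) *\<^sub>R (x\<^sub>1, b) + t *\<^sub>R (u, s) \<in> C" using t by (intro convexD[OF C(1) C(2) us]) auto
    then have "(x\<^sub>1 + t *\<^sub>R (u - x\<^sub>1), (1 - t) * b + t * s) \<in> C" by (simp add: algebra_simps)
    from lower[OF this U'] have "2 * \<sigma> * a \<le> 2 * \<sigma> * ((1 - t) * b + t * s)"
      using \<sigma> by (intro mult_left_mono) auto
    also have "\<dots> = (2 * \<sigma> - 1) * b + s" using \<sigma> by (simp add: t_def field_simps)
    finally show ?thesis using ab by (simp add: \<sigma>_def[symmetric] algebra_simps)
  qed
  moreover have "2 * (b - a) \<ge> 0" using ab by simp
  ultimately obtain \<phi> :: "'a dual" where "\<And>u s. (u, s) \<in> C \<Longrightarrow> a + dual_apply \<phi> (u - x\<^sub>1) \<le> s"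
    using affine_minorant_of_seminorm[OF C(1) q(1,2,4,5,6)] by metis
  then show thesis using that[of \<phi> "a - dual_apply \<phi> x\<^sub>1"] by (simp add: dual_apply_diff algebra_simps)
qed

text \<open>Inside the unit gauge ball around \<open>x\<^sub>0\<close> the bound \<open>r\<close>
  applies. Outside, the given minorant decreases at most as fast as the gauge, which is at least 1
  there and so absorbs the gap at \<open>x\<^sub>0\<close>. Here \<open>C\<close> may have no point
  over \<open>U\<close>, so values outside a domain can be prescribed.\<close>

lemma convex_local_bound_minorant:
  fixes C :: "('a::locally_convex_space \<times> real) set" and \<phi>\<^sub>0 :: "'a dual"
  assumes C: "convex C" and minorant: "\<And>u s. (u, s) \<in> C \<Longrightarrow> dual_apply \<phi>\<^sub>0 u + c \<le> s"
    and U: "open U" "x\<^sub>0 \<in> U" and lower: "\<And>u s. (u, s) \<in> C \<Longrightarrow> u \<in> U \<Longrightarrow> r \<le> s"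
  obtains \<phi> :: "'a dual" where "\<And>u s. (u, s) \<in> C \<Longrightarrow> r + dual_apply \<phi> (u - x\<^sub>0) \<le> s"
proof -
  \<comment> \<open>Shrinking the neighbourhood to where \<open>\<phi>\<^sub>0\<close> is below 1 in
    absolute value makes the gauge dominate its negative.\<close>
  have "open (dual_apply \<phi>\<^sub>0 -` {-1<..<1})"
    by (intro open_vimage dual_apply_continuous) simp
  then have "open ({v. x\<^sub>0 + v \<in> U} \<inter> dual_apply \<phi>\<^sub>0 -` {-1<..<1})"
    using open_translate_tvs[OF U(1)] by blast
  moreover have "0 \<in> {v. x\<^sub>0 + v \<in> U} \<inter> dual_apply \<phi>\<^sub>0 -` {-1<..<1}"
    using U(2) by (simp add: dual_apply_zero)
  ultimately obtain q V where q: "sublinear q" "\<And>x. q (- x) = q x" "\<And>x. 0 \<le> q x"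
    "open V" "0 \<in> V" "\<And>x. x \<in> V \<Longrightarrow> q x \<le> 1"
    "\<And>x. q x < 1 \<Longrightarrow> x \<in> {v. x\<^sub>0 + v \<in> U} \<inter> dual_apply \<phi>\<^sub>0 -` {-1<..<1}"
    using Minkowski_gauge by blast
  have \<phi>\<^sub>0_ge: "- q v \<le> dual_apply \<phi>\<^sub>0 v" for v
  proof (rule ccontr)
    assume "\<not> - q v \<le> dual_apply \<phi>\<^sub>0 v"
    then have less: "q v < - dual_apply \<phi>\<^sub>0 v" by simp
    \<comment> \<open>Dividing \<open>v\<close> by \<open>t\<close> moves it into the open unit
      gauge ball, where \<open>\<phi>\<^sub>0\<close> would take the excluded value -1.\<close>
    define t where "t = - dual_apply \<phi>\<^sub>0 v"
    have t: "t > 0" using less q(3)[of v] by (simp add: t_def)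
    have "q (inverse t *\<^sub>R v) < 1"
      using sublinear_scale_pos[OF q(1), of "inverse t" v] t less
      by (simp add: t_def[symmetric]) (simp add: field_simps)
    then have "-1 < dual_apply \<phi>\<^sub>0 (inverse t *\<^sub>R v)" using q(7) by force
    then have "-1 < inverse t * dual_apply \<phi>\<^sub>0 v" by (simp only: dual_apply_scaleR real_scaleR_def)
    then show False using t by (simp add: t_def)
  qed
  \<comment> \<open>The value of the given minorant at \<open>x\<^sub>0\<close>. In the factor
    below, 1 pays for its decrease and |r - d| for the gap.\<close>
  define d where "d = dual_apply \<phi>\<^sub>0 x\<^sub>0 + c"
  have "r \<le> s + (1 + \<bar>r - d\<bar>) * q (u - x\<^sub>0)" if us: "(u, s) \<in> C" for u s
  proof (cases "q (u - x\<^sub>0) < 1")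
    case True
    then have "r \<le> s" using q(7)[of "u - x\<^sub>0"] lower[OF us] by simp
    then show ?thesis using q(3)[of "u - x\<^sub>0"] by (simp add: add_increasing2)
  next
    case False
    have "d - q (u - x\<^sub>0) \<le> s"
      using minorant[OF us] \<phi>\<^sub>0_ge[of "u - x\<^sub>0"] by (simp add: d_def dual_apply_diff)
    moreover have "\<bar>r - d\<bar> * 1 \<le> \<bar>r - d\<bar> * q (u - x\<^sub>0)" using False by (intro mult_left_mono) auto
    ultimately show ?thesis by (simp add: distrib_right)
  qed
  moreover have "1 + \<bar>r - d\<bar> \<ge> 0" by simp
  ultimately show thesis
    using affine_minorant_of_seminorm[OF C(1) q(1,2,4,5,6)] that by metis
qed

subsection \<open>The weak* dual\<close>

text \<open>Neighbourhood filters of a generated topology are infima over the subbasis, so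
  convergence can be tested on evaluations.\<close>

lemma tendsto_dual_iff:
  fixes f :: "'b \<Rightarrow> 'a::{real_vector, topological_space} dual"
  shows "(f \<longlongrightarrow> \<phi>) F \<longleftrightarrow> (\<forall>x. ((\<lambda>y. dual_apply (f y) x) \<longlongrightarrow> dual_apply \<phi> x) F)"
proof
  have cont: "open ((\<lambda>\<phi>::'a dual. dual_apply \<phi> x) -` V)" if "open V" for x V
    unfolding open_dual_def using that by (intro generate_topology.Basis) blast
  assume lim: "(f \<longlongrightarrow> \<phi>) F"
  show "\<forall>x. ((\<lambda>y. dual_apply (f y) x) \<longlongrightarrow> dual_apply \<phi> x) F"
  proof (intro allI topological_tendstoI)
    fix x V assume "open V" "dual_apply \<phi> x \<in> V"
    with topological_tendstoD[OF lim cont[of V x]]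
    show "\<forall>\<^sub>F y in F. dual_apply (f y) x \<in> V" by simp
  qed
next
  assume lim: "\<forall>x. ((\<lambda>y. dual_apply (f y) x) \<longlongrightarrow> dual_apply \<phi> x) F"
  have nhds: "nhds \<phi> = (INF S\<in>{S \<in> {(\<lambda>\<phi>::'a dual. dual_apply \<phi> x) -` V |x V. open V}. \<phi> \<in> S}. principal S)"
    by (rule nhds_generated_topology) (rule ext, simp add: open_dual_def)
  show "(f \<longlongrightarrow> \<phi>) F"
    unfolding nhds filterlim_INF filterlim_principal
  proof
    fix S assume "S \<in> {S \<in> {(\<lambda>\<phi>::'a dual. dual_apply \<phi> x) -` V |x V. open V}. \<phi> \<in> S}"
    then obtain x V where S: "S = (\<lambda>\<phi>. dual_apply \<phi> x) -` V" "open V" "dual_apply \<phi> x \<in> V" by auto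
    from topological_tendstoD[OF lim[rule_format, of x] S(2,3)]
    show "\<forall>\<^sub>F y in F. f y \<in> S" by (simp add: S(1))
  qed
qed

lemma tendsto_dual_apply:
  "(f \<longlongrightarrow> \<phi>) F \<Longrightarrow> ((\<lambda>y. dual_apply (f y) x) \<longlongrightarrow> dual_apply \<phi> x) F"
  by (simp add: tendsto_dual_iff)

lemma continuous_on_dual_apply: "continuous_on UNIV (\<lambda>\<phi>. dual_apply \<phi> x)"
  by (auto simp: continuous_on_def intro: tendsto_dual_apply)

lemma weak_star_nhd_zero:
  fixes U :: "'a::{real_vector, topological_space} dual set"
  assumes "open U" "0 \<in> U"
  obtains S e where "finite S" "e > 0" "{\<phi>. \<forall>x\<in>S. \<bar>dual_apply \<phi> x\<bar> < e} \<subseteq> U"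
proof -
  have "\<exists>S e. finite S \<and> e > 0 \<and> {\<phi>. \<forall>x\<in>S. \<bar>dual_apply \<phi> x\<bar> < e} \<subseteq> U"
    using assms unfolding open_dual_def
  proof (induction rule: generate_topology.induct)
    case UNIV
    show ?case by (intro exI[of _ "{}"] exI[of _ 1]) auto
  next
    case (Int A B)
    then obtain S e T d where "finite S" "e > 0" "{\<phi>. \<forall>x\<in>S. \<bar>dual_apply \<phi> x\<bar> < e} \<subseteq> A"
      "finite T" "d > 0" "{\<phi>. \<forall>x\<in>T. \<bar>dual_apply \<phi> x\<bar> < d} \<subseteq> B"
      by auto
    then show ?case by (intro exI[of _ "S \<union> T"] exI[of _ "min e d"]) auto
  next
    case (UN K)
    then obtain A where "A \<in> K" "0 \<in> A" by auto
    with UN(2) show ?case by (meson Union_upper order_trans)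
  next
    case (Basis A)
    then obtain x V where A: "A = (\<lambda>\<phi>. dual_apply \<phi> x) -` V" "open V" by auto
    then have "0 \<in> V" using Basis(2) by (simp add: zero_dual.rep_eq)
    then obtain e where "e > 0" "ball 0 e \<subseteq> V" using A(2) openE by blast
    then show ?case using A(1)
      by (intro exI[of _ "{x}"] exI[of _ e]) (auto simp: subset_iff dist_real_def)
  qed
  then show thesis using that by blast
qed

text \<open>Makes the minorant lemmas applicable in the dual itself. The basic neighbourhoods of 0
  are finite intersections of strips, which are convex.\<close>

instance dual :: ("{real_vector, topological_space}") locally_convex_space
proof
  fix a b :: "'a dual"
  show "LIM x nhds a \<times>\<^sub>F nhds b. fst x + snd x :> nhds (a + b)"
    by (auto simp: tendsto_dual_iff plus_dual.rep_eq
        intro!: tendsto_add tendsto_dual_apply filterlim_fst filterlim_snd)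
  show "(uminus \<longlongrightarrow> - a) (nhds a)"
    by (auto simp: tendsto_dual_iff uminus_dual.rep_eq
        intro!: tendsto_minus tendsto_dual_apply filterlim_ident)
next
  fix c :: real and a :: "'a dual"
  show "LIM p nhds c \<times>\<^sub>F nhds a. fst p *\<^sub>R snd p :> nhds (c *\<^sub>R a)"
    by (auto simp: tendsto_dual_iff scaleR_dual.rep_eq
        intro!: tendsto_mult tendsto_dual_apply filterlim_fst filterlim_snd)
next
  fix U :: "'a dual set" assume "open U" "0 \<in> U"
  then obtain S e where S: "finite S" "e > 0" "{\<phi>. \<forall>x\<in>S. \<bar>dual_apply \<phi> x\<bar> < e} \<subseteq> U"
    using weak_star_nhd_zero by blast
  define V where "V = (\<Inter>x\<in>S. (\<lambda>\<phi>::'a dual. dual_apply \<phi> x) -` {-e<..<e})"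
  have V_iff: "\<phi> \<in> V \<longleftrightarrow> (\<forall>x\<in>S. \<bar>dual_apply \<phi> x\<bar> < e)" for \<phi> by (auto simp: V_def abs_less_iff)
  have "open V" unfolding V_def
    using S by (intro open_INT open_vimage continuous_on_dual_apply ballI) auto
  moreover have "u *\<^sub>R \<phi> + v *\<^sub>R \<psi> \<in> V" if "\<phi> \<in> V" "\<psi> \<in> V" "u \<ge> 0" "v \<ge> 0" "u + v = 1" for \<phi> \<psi> u v
    unfolding V_iff
  proof
    fix x assume "x \<in> S"
    then show "\<bar>dual_apply (u *\<^sub>R \<phi> + v *\<^sub>R \<psi>) x\<bar> < e"
      using that convex_bound_lt[of "\<bar>dual_apply \<phi> x\<bar>" e "\<bar>dual_apply \<psi> x\<bar>" u v]
        abs_triangle_ineq[of "u * dual_apply \<phi> x" "v * dual_apply \<psi> x"]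
      by (simp add: V_iff plus_dual.rep_eq scaleR_dual.rep_eq abs_mult)
  qed
  moreover have "0 \<in> V" "V \<subseteq> U" using S by (auto simp: V_iff subset_iff zero_dual.rep_eq)
  ultimately show "\<exists>V. open V \<and> 0 \<in> V \<and> V \<subseteq> U \<and>
      (\<forall>x\<in>V. \<forall>y\<in>V. \<forall>u\<ge>0. \<forall>v\<ge>0. u + v = 1 \<longrightarrow> u *\<^sub>R x + v *\<^sub>R y \<in> V)"
    by blast
qed

text \<open>A linear form vanishing on the common kernel of finitely many evaluations is a linear
  combination of them, hence itself an evaluation. The induction subtracts a multiple of the
  evaluation at \<open>x\<close>.\<close>

lemma linear_vanishing_on_annihilator:
  fixes L :: "'a::{real_vector, topological_space} dual \<Rightarrow> real"
  assumes "finite S" "linear L"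
    and "\<And>\<phi>. (\<forall>x\<in>S. dual_apply \<phi> x = 0) \<Longrightarrow> L \<phi> = 0"
  shows "\<exists>y. \<forall>\<phi>. L \<phi> = dual_apply \<phi> y"
  using assms
proof (induction S arbitrary: L rule: finite_induct)
  case empty
  then show ?case by (intro exI[of _ 0]) (auto simp: dual_apply_zero)
next
  case (insert x S)
  show ?case
  proof (cases "\<forall>\<phi>. (\<forall>z\<in>S. dual_apply \<phi> z = 0) \<longrightarrow> dual_apply \<phi> x = 0")
    case True
    then show ?thesis using insert by auto
  next
    case False
    then obtain \<psi> :: "'a dual" where \<psi>: "\<forall>z\<in>S. dual_apply \<psi> z = 0" "dual_apply \<psi> x \<noteq> 0" by blast
    \<comment> \<open>This factor makes the difference vanish at \<psi>. Any \<phi> annihilating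
      \<open>S\<close> can be corrected by a multiple of \<psi> so as to annihilate \<open>x\<close>
      as well.\<close>
    define k where "k = L \<psi> / dual_apply \<psi> x"
    have lin: "linear (\<lambda>\<phi>. L \<phi> - k * dual_apply \<phi> x)"
      using insert.prems(1)
      by (auto simp: linear_iff plus_dual.rep_eq scaleR_dual.rep_eq algebra_simps)
    have "L \<phi> - k * dual_apply \<phi> x = 0" if "\<forall>z\<in>S. dual_apply \<phi> z = 0" for \<phi>
    proof -
      have "L (\<phi> - (dual_apply \<phi> x / dual_apply \<psi> x) *\<^sub>R \<psi>) = 0"
        using that \<psi> by (intro insert.prems(2)) (auto simp: minus_dual.rep_eq scaleR_dual.rep_eq)
      then show ?thesis
        by (simp add: linear_diff[OF insert.prems(1)] linear_scale[OF insert.prems(1)] k_def)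
    qed
    from insert.IH[OF lin this] obtain y where y: "\<And>\<phi>. L \<phi> - k * dual_apply \<phi> x = dual_apply \<phi> y"
      by blast
    have "L \<phi> = dual_apply \<phi> (y + k *\<^sub>R x)" for \<phi>
      using y[of \<phi>] by (simp add: dual_apply_add dual_apply_scaleR)
    then show ?thesis by blast
  qed
qed

text \<open>Continuity bounds \<open>L\<close> on a basic neighbourhood given by finitely many
  points. All multiples of a form annihilating these points lie in it, so \<open>L\<close> vanishes
  on such forms.\<close>

lemma weak_star_dual_eq_eval:
  fixes L :: "'a::{real_vector, topological_space} dual dual"
  obtains y where "\<And>\<phi>. dual_apply L \<phi> = dual_apply \<phi> y"
proof -
  have "open (dual_apply L -` {..<1})" by (intro open_vimage dual_apply_continuous) simp
  moreover have "0 \<in> dual_apply L -` {..<1}" by (simp add: dual_apply_zero)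
  ultimately obtain S e where S: "finite S" "e > 0"
    "{\<phi>. \<forall>x\<in>S. \<bar>dual_apply \<phi> x\<bar> < e} \<subseteq> dual_apply L -` {..<1}"
    by (rule weak_star_nhd_zero)
  have "dual_apply L \<phi> = 0" if "\<forall>x\<in>S. dual_apply \<phi> x = 0" for \<phi>
  proof (rule ccontr)
    assume nz: "dual_apply L \<phi> \<noteq> 0"
    have "(1 / dual_apply L \<phi>) *\<^sub>R \<phi> \<in> dual_apply L -` {..<1}"
      using that S by (auto simp: subset_iff scaleR_dual.rep_eq)
    then show False using nz by (simp add: dual_apply_scaleR)
  qed
  with linear_vanishing_on_annihilator[OF S(1) dual_apply_linear] that show thesis by blast
qed

subsection \<open>Conjugates and subdifferentials\<close>

lemma dual_apply_sum: "dual_apply (\<Sum>i\<in>I. w i) x = (\<Sum>i\<in>I. dual_apply (w i) x)"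
  by (induction I rule: infinite_finite_induct) (auto simp: zero_dual.rep_eq plus_dual.rep_eq)

lemma dual_eval:
  obtains L :: "'a::{real_vector, topological_space} dual dual"
  where "\<And>\<phi>. dual_apply L \<phi> = dual_apply \<phi> x"
proof -
  have "linear (\<lambda>\<phi>::'a dual. dual_apply \<phi> x)"
    by (auto simp: linear_iff plus_dual.rep_eq scaleR_dual.rep_eq)
  then show thesis
    using that[of "Dual (\<lambda>\<phi>. dual_apply \<phi> x)"] continuous_on_dual_apply[of x]
    by (simp add: Dual_inverse)
qed

lemma proper_not_MInf: "proper f \<Longrightarrow> f x \<noteq> -\<infinity>"
  by (metis proper_def less_irrefl)

lemma conjugate_le_iff:
  assumes "\<And>x. f x \<noteq> -\<infinity>"
  shows "conjugate f \<phi> \<le> ereal s \<longleftrightarrow> (\<forall>x. ereal (dual_apply \<phi> x - s) \<le> f x)"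
proof -
  have "ereal (dual_apply \<phi> x) - f x \<le> ereal s \<longleftrightarrow> ereal (dual_apply \<phi> x - s) \<le> f x" for x
    using assms[of x] by (cases "f x") auto
  then show ?thesis by (simp add: conjugate_def SUP_le_iff)
qed

lemma proper_conjugate_not_MInf:
  assumes "proper f"
  shows "conjugate f \<phi> \<noteq> -\<infinity>"
proof -
  obtain x where "f x < \<infinity>" using assms by (auto simp: proper_def effective_dom_def)
  then have "-\<infinity> < ereal (dual_apply \<phi> x) - f x"
    using proper_not_MInf[OF assms, of x] by (cases "f x") auto
  also have "\<dots> \<le> conjugate f \<phi>" unfolding conjugate_def by (rule SUP_upper) simp
  finally show ?thesis by auto
qed

lemma proper_conjugate_le_iff:
  "proper f \<Longrightarrow> conjugate f \<phi> \<le> ereal s \<longleftrightarrow> (\<forall>x. ereal (dual_apply \<phi> x - s) \<le> f x)"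
  by (rule conjugate_le_iff) (rule proper_not_MInf)

lemma sum_ereal_not_MInf:
  fixes h :: "'i \<Rightarrow> ereal"
  shows "(\<And>i. i \<in> I \<Longrightarrow> h i \<noteq> -\<infinity>) \<Longrightarrow> (\<Sum>i\<in>I. h i) \<noteq> -\<infinity>"
  by (induction I rule: infinite_finite_induct) auto

text \<open>Moving the terms in \<open>x\<close> to one side turns the defining inequality into an
  affine minorant of \<open>f\<close>. In this Fenchel--Young form subdifferentials become sublevel
  conditions on the conjugate.\<close>

lemma eps_subdiff_iff:
  assumes "proper f" "f x = ereal r"
  shows "\<phi> \<in> eps_subdiff \<epsilon> f x \<longleftrightarrow> conjugate f \<phi> \<le> ereal (dual_apply \<phi> x - r + \<epsilon>)"
proof -
  have "ereal (dual_apply \<phi> (y - x)) + f x \<le> f y + ereal \<epsilon> \<longleftrightarrow>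
      ereal (dual_apply \<phi> y - (dual_apply \<phi> x - r + \<epsilon>)) \<le> f y" for y
    using proper_not_MInf[OF assms(1), of y] assms(2)
    by (cases "f y") (auto simp: dual_apply_diff algebra_simps)
  then show ?thesis
    using assms(2) by (simp add: eps_subdiff_def proper_conjugate_le_iff[OF assms(1)])
qed

lemma closed_eps_subdiff: "closed (eps_subdiff \<epsilon> f x)"
proof -
  have cl: "closed {\<phi>. dual_apply \<phi> (y - x) \<le> c}" for y c
    by (intro closed_Collect_le continuous_on_dual_apply continuous_on_const)
  have "closed {\<phi>. ereal (dual_apply \<phi> (y - x)) + ereal r \<le> f y + ereal \<epsilon>}" for y r
    using cl[of y "real_of_ereal (f y) + \<epsilon> - r"] by (cases "f y") (auto simp: algebra_simps)
  then have "closed (\<Inter>y. {\<phi>. ereal (dual_apply \<phi> (y - x)) + ereal r \<le> f y + ereal \<epsilon>})" for r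
    by (intro closed_INT) auto
  moreover have "(\<Inter>y. {\<phi>. P \<phi> y}) = {\<phi>. \<forall>y. P \<phi> y}" for P :: "'a dual \<Rightarrow> 'a \<Rightarrow> bool" by auto
  ultimately show ?thesis by (cases "f x") (auto simp: eps_subdiff_def)
qed

lemma eps_subdiff_mono: "\<epsilon> \<le> \<delta> \<Longrightarrow> eps_subdiff \<epsilon> f x \<subseteq> eps_subdiff \<delta> f x"
  unfolding eps_subdiff_def by (auto intro: order_trans intro!: add_left_mono)

lemma lsc_conjugate:
  assumes "\<And>x. f x \<noteq> -\<infinity>"
  shows "lsc (conjugate f)"
proof -
  have "open {\<phi>. a < ereal (dual_apply \<phi> x) - f x}" for a x
  proof (cases "f x")
    case (real r)
    show ?thesis unfolding real
      by (intro open_Collect_less continuous_on_const)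
        (auto intro!: continuous_on_ereal continuous_on_diff continuous_on_dual_apply)
  qed (use assms in auto)
  then have "open (\<Union>x. {\<phi>. a < ereal (dual_apply \<phi> x) - f x})" for a by blast
  moreover have "{\<phi>. a < conjugate f \<phi>} = (\<Union>x. {\<phi>. a < ereal (dual_apply \<phi> x) - f x})" for a
    by (auto simp: conjugate_def less_SUP_iff)
  ultimately show ?thesis by (simp add: lsc_def)
qed

section \<open>Lower semicontinuous hulls and the Fenchel--Moreau theorem\<close>

lemma open_less_lsc_hull: "open {x. a < lsc_hull f x}"
proof -
  have "{x. a < lsc_hull f x} = (\<Union>g\<in>{g. lsc g \<and> (\<forall>y. g y \<le> f y)}. {x. a < g x})"
    by (auto simp: lsc_hull_def less_SUP_iff)
  then show ?thesis by (auto simp: lsc_def)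
qed

lemma lsc_hull_le: "lsc_hull f x \<le> f x"
  unfolding lsc_hull_def by (rule SUP_least) auto

lemma lsc_hull_greatest: "lsc g \<Longrightarrow> (\<And>y. g y \<le> f y) \<Longrightarrow> g x \<le> lsc_hull f x"
  unfolding lsc_hull_def by (rule SUP_upper) auto

lemma convex_epigraph:
  assumes "convex_fun f"
  shows "convex {(u, s). f u \<le> ereal s}"
  unfolding convex_alt
proof clarsimp
  fix x s y s' and t :: real
  assume *: "f x \<le> ereal s" "f y \<le> ereal s'" "0 \<le> t" "t \<le> 1"
  consider "t = 0" | "t = 1" | "0 < t" "t < 1" using * by fastforce
  then show "f ((1 - t) *\<^sub>R x + t *\<^sub>R y) \<le> ereal ((1 - t) * s + t * s')"
  proof cases
    case 3
    then have "f ((1 - t) *\<^sub>R x + t *\<^sub>R y) \<le> ereal (1 - t) * f x + ereal t * f y"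
      using assms by (auto simp: convex_fun_def)
    also have "\<dots> \<le> ereal (1 - t) * ereal s + ereal t * ereal s'"
      using * by (intro add_mono ereal_mult_left_mono) auto
    finally show ?thesis by simp
  qed (use * in auto)
qed

text \<open>Where the hull exceeds \<open>a\<close>, so does \<open>f\<close>, and this set is an
  open neighbourhood of \<open>x\<close>. As \<open>f\<close> is finite at \<open>x\<close>,
  convexity extends the local bound to a continuous affine minorant.\<close>

lemma lsc_hull_affine_minorant:
  fixes f :: "'a::locally_convex_space \<Rightarrow> ereal"
  assumes f: "convex_fun f" and x: "f x < \<infinity>" "-\<infinity> < lsc_hull f x"
  obtains \<phi> c where "\<And>y. ereal (dual_apply \<phi> y + c) \<le> f y"
proof -
  obtain b where b: "f x = ereal b" using x lsc_hull_le[of f x] by (cases "f x") auto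
  obtain a where a: "ereal a < lsc_hull f x"
    using x(2) by (metis ereal_dense2 less_ereal.simps(3) order_le_less_trans)
  obtain \<phi> c where \<phi>: "\<And>u s. (u, s) \<in> {(u, s). f u \<le> ereal s} \<Longrightarrow> dual_apply \<phi> u + c \<le> s"
  proof (rule convex_affine_minorant[OF convex_epigraph[OF f], of x b "{u. ereal a < lsc_hull f u}" a])
    fix u s assume "(u, s) \<in> {(u, s). f u \<le> ereal s}" "u \<in> {u. ereal a < lsc_hull f u}"
    then have "ereal a < lsc_hull f u" "f u \<le> ereal s" by auto
    from this(1) order_trans[OF lsc_hull_le[of f u] this(2)] have "ereal a < ereal s"
      by (rule less_le_trans)
    then show "a \<le> s" by simp
  qed (use a b open_less_lsc_hull in auto)
  have "ereal (dual_apply \<phi> y + c) \<le> f y" for y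
  proof (rule ereal_le_real)
    fix s assume "f y \<le> ereal s"
    then show "ereal (dual_apply \<phi> y + c) \<le> ereal s" using \<phi>[of y s] by simp
  qed
  then show thesis by (rule that)
qed

text \<open>The point \<open>x\<close> supplies a first affine minorant and the hull a local bound
  \<open>k\<close> around \<open>y\<close>. Together they give a minorant with the exact value
  \<open>k\<close> at \<open>y\<close>, also when the hull is infinite there.\<close>

lemma fenchel_moreau:
  fixes f :: "'a::locally_convex_space \<Rightarrow> ereal"
  assumes f: "convex_fun f" and x: "f x < \<infinity>" "-\<infinity> < lsc_hull f x" and k: "ereal k < lsc_hull f y"
  obtains \<phi> c where "\<And>z. ereal (dual_apply \<phi> z + c) \<le> f z" "dual_apply \<phi> y + c = k"
proof -
  obtain \<phi>\<^sub>0 c\<^sub>0 where \<phi>\<^sub>0: "\<And>y. ereal (dual_apply \<phi>\<^sub>0 y + c\<^sub>0) \<le> f y"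
    using lsc_hull_affine_minorant[OF f x] by blast
  obtain \<phi> :: "'a dual" where
    \<phi>: "\<And>u s. (u, s) \<in> {(u, s). f u \<le> ereal s} \<Longrightarrow> k + dual_apply \<phi> (u - y) \<le> s"
  proof (rule convex_local_bound_minorant[OF convex_epigraph[OF f], of \<phi>\<^sub>0 c\<^sub>0 "{u. ereal k < lsc_hull f u}" y k])
    fix u s assume "(u, s) \<in> {(u, s). f u \<le> ereal s}"
    then show "dual_apply \<phi>\<^sub>0 u + c\<^sub>0 \<le> s" using \<phi>\<^sub>0[of u] order_trans by fastforce
  next
    fix u s assume "(u, s) \<in> {(u, s). f u \<le> ereal s}" "u \<in> {u. ereal k < lsc_hull f u}"
    then have "ereal k < lsc_hull f u" "f u \<le> ereal s" by auto
    from this(1) order_trans[OF lsc_hull_le[of f u] this(2)] have "ereal k < ereal s"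
      by (rule less_le_trans)
    then show "k \<le> s" by simp
  qed (use k open_less_lsc_hull in auto)
  have "ereal (dual_apply \<phi> z + (k - dual_apply \<phi> y)) \<le> f z" for z
  proof (rule ereal_le_real)
    fix s assume "f z \<le> ereal s"
    then show "ereal (dual_apply \<phi> z + (k - dual_apply \<phi> y)) \<le> ereal s"
      using \<phi>[of z s] by (simp add: dual_apply_diff)
  qed
  then show thesis by (rule that) simp
qed

lemma less_sum_ereal_approx:
  fixes h :: "'i \<Rightarrow> ereal"
  assumes "finite I" "\<And>i. i \<in> I \<Longrightarrow> h i \<noteq> -\<infinity>" "ereal k < (\<Sum>i\<in>I. h i)"
  shows "\<exists>r. (\<forall>i\<in>I. ereal (r i) < h i) \<and> k < (\<Sum>i\<in>I. r i)"
  using assms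
proof (induction I arbitrary: k rule: finite_induct)
  case (insert i I)
  have "(\<Sum>i\<in>I. h i) \<noteq> -\<infinity>" using insert by (intro sum_ereal_not_MInf) auto
  moreover have "\<exists>a b. ereal a < x \<and> ereal b < y \<and> k < a + b"
    if "x \<noteq> -\<infinity>" "y \<noteq> -\<infinity>" "ereal k < x + y" for x y
  proof (cases x)
    case (real x')
    show ?thesis
    proof (cases y)
      case (real y')
      \<comment> \<open>A third of the slack is taken off each summand, so that a third
        remains.\<close>
      then show ?thesis using that \<open>x = ereal x'\<close>
        by (intro exI[of _ "x' - (x' + y' - k) / 3"] exI[of _ "y' - (x' + y' - k) / 3"])
          (auto simp: field_simps)
    next
      case PInf
      then show ?thesis using real by (intro exI[of _ "x' - 1"] exI[of _ "k - x' + 2"]) auto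
    qed (use that in auto)
  next
    case PInf
    obtain b where "ereal b < y"
      using \<open>y \<noteq> -\<infinity>\<close> by (metis ereal_dense2 ereal_infty_less(2))
    then show ?thesis using PInf by (intro exI[of _ "k - b + 1"] exI[of _ b]) auto
  qed (use that in auto)
  ultimately obtain a b where ab: "ereal a < h i" "ereal b < (\<Sum>i\<in>I. h i)" "k < a + b"
    using insert by (metis insertI1 sum.insert)
  obtain r where r: "\<forall>i\<in>I. ereal (r i) < h i" "b < (\<Sum>i\<in>I. r i)"
    using insert.IH[OF _ ab(2)] insert.prems by auto
  have "(\<Sum>j\<in>I. (r(i := a)) j) = (\<Sum>j\<in>I. r j)" using insert by (intro sum.cong) auto
  then show ?case using r ab insert by (intro exI[of _ "r(i := a)"]) auto
qed auto

text \<open>The pairs \<open>(\<phi>, a)\<close> with \<open>conjugate_split I f \<phi> a\<close> lie between the strict epigraph and the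
  epigraph of the infimal convolution of the conjugates.\<close>

definition conjugate_split ::
    "'i set \<Rightarrow> ('i \<Rightarrow> 'a::{real_vector, topological_space} \<Rightarrow> ereal) \<Rightarrow> 'a dual \<Rightarrow> real \<Rightarrow> bool" where
  "conjugate_split I f \<phi> a \<longleftrightarrow>
     (\<exists>w s. (\<Sum>i\<in>I. w i) = \<phi> \<and> (\<Sum>i\<in>I. s i) = a \<and> (\<forall>i\<in>I. conjugate (f i) (w i) \<le> ereal (s i)))"

section \<open>Splittings and the infimal convolution of the conjugates\<close>

lemma conjugate_split_mono:
  assumes "finite I" "I \<noteq> {}" "conjugate_split I f \<phi> a" "a \<le> b"
  shows "conjugate_split I f \<phi> b"
proof -
  obtain w s where ws: "(\<Sum>i\<in>I. w i) = \<phi>" "(\<Sum>i\<in>I. s i) = a"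
    "\<forall>i\<in>I. conjugate (f i) (w i) \<le> ereal (s i)"
    using assms(3) by (auto simp: conjugate_split_def)
  \<comment> \<open>The surplus is spread evenly over the indices, so \<open>I\<close> must be
    nonempty.\<close>
  define d where "d = (b - a) / card I"
  have "card I > 0" using assms by (simp add: card_gt_0_iff)
  then have d: "d \<ge> 0" "card I * d = b - a" using assms(4) by (auto simp: d_def)
  have "(\<Sum>i\<in>I. s i + d) = b" using ws(2) d(2) by (simp add: sum.distrib)
  moreover have "conjugate (f i) (w i) \<le> ereal (s i + d)" if "i \<in> I" for i
    using ws(3) that d(1) by (meson ereal_less_eq(3) le_add_same_cancel1 order_trans)
  ultimately show ?thesis using ws(1) unfolding conjugate_split_def by blast
qed

text \<open>Strictness provides a decomposition with value below \<open>a\<close>; its conjugates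
  are finite because none is \<open>-\<infinity>\<close> and their sum is below a real
  number.\<close>

lemma inf_conv_less_iff:
  assumes I: "finite I" and f: "\<And>i. i \<in> I \<Longrightarrow> proper (f i)"
  shows "inf_conv I (\<lambda>i. conjugate (f i)) \<phi> < ereal a \<longleftrightarrow> (\<exists>b<a. conjugate_split I f \<phi> b)"
proof
  assume "inf_conv I (\<lambda>i. conjugate (f i)) \<phi> < ereal a"
  then obtain w where w: "(\<Sum>i\<in>I. w i) = \<phi>" "(\<Sum>i\<in>I. conjugate (f i) (w i)) < ereal a"
    unfolding inf_conv_def INF_less_iff by auto
  define s where "s i = real_of_ereal (conjugate (f i) (w i))" for i
  have s: "conjugate (f i) (w i) = ereal (s i)" if "i \<in> I" for i
  proof -
    have "(\<Sum>i\<in>I. conjugate (f i) (w i)) \<noteq> \<infinity>" using w(2) by auto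
    then have "conjugate (f i) (w i) \<noteq> \<infinity>" using I that unfolding sum_Pinfty by blast
    then show ?thesis using proper_conjugate_not_MInf[OF f[OF that], of "w i"]
      by (auto simp: s_def ereal_real)
  qed
  have "ereal (\<Sum>i\<in>I. s i) < ereal a" using w(2) s by simp
  then show "\<exists>b<a. conjugate_split I f \<phi> b" using w(1) s unfolding conjugate_split_def
    by (intro exI[of _ "\<Sum>i\<in>I. s i"] conjI exI[of _ w] exI[of _ s]) auto
next
  assume "\<exists>b<a. conjugate_split I f \<phi> b"
  then obtain b w s where ws: "b < a" "(\<Sum>i\<in>I. w i) = \<phi>" "(\<Sum>i\<in>I. s i) = b"
    "\<forall>i\<in>I. conjugate (f i) (w i) \<le> ereal (s i)"
    unfolding conjugate_split_def by auto
  have "inf_conv I (\<lambda>i. conjugate (f i)) \<phi> \<le> (\<Sum>i\<in>I. conjugate (f i) (w i))"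
    unfolding inf_conv_def using ws(2) by (intro INF_lower) simp
  also have "\<dots> \<le> (\<Sum>i\<in>I. ereal (s i))" using ws(4) by (intro sum_mono) auto
  also have "\<dots> < ereal a" using ws(1,3) by simp
  finally show "inf_conv I (\<lambda>i. conjugate (f i)) \<phi> < ereal a" .
qed

text \<open>The infimum may fail to be attained, hence the slack \<eta>, which becomes the
  intersection over \<eta> in (iv).\<close>

lemma inf_conv_le_iff:
  assumes I: "finite I" "I \<noteq> {}" and f: "\<And>i. i \<in> I \<Longrightarrow> proper (f i)"
  shows "inf_conv I (\<lambda>i. conjugate (f i)) \<phi> \<le> ereal a \<longleftrightarrow> (\<forall>\<eta>>0. conjugate_split I f \<phi> (a + \<eta>))"
    (is "?h \<le> _ \<longleftrightarrow> _")
proof (intro iffI allI impI)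
  fix \<eta> :: real assume "?h \<le> ereal a" "\<eta> > 0"
  then have "?h < ereal (a + \<eta>)" by (auto elim: le_less_trans)
  then obtain b where "b < a + \<eta>" "conjugate_split I f \<phi> b"
    using inf_conv_less_iff[of I f \<phi> "a + \<eta>"] I f by blast
  then show "conjugate_split I f \<phi> (a + \<eta>)" by (auto intro: conjugate_split_mono[OF I])
next
  assume *: "\<forall>\<eta>>0. conjugate_split I f \<phi> (a + \<eta>)"
  show "?h \<le> ereal a"
  proof (rule ereal_le_epsilon2)
    fix e :: real assume e: "e > 0"
    then have "?h < ereal (a + e)"
      using * inf_conv_less_iff[of I f \<phi> "a + e"] I f
      by (metis add_strict_left_mono field_sum_of_halves half_gt_zero less_add_same_cancel1)
    then show "?h \<le> ereal a + ereal e" by simp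
  qed
qed

text \<open>Affine minorants of the \<open>f i\<close> add up to an affine minorant of the
  sum.\<close>

lemma conjugate_split_imp_conjugate_le:
  assumes I: "finite I" and f: "\<And>i. i \<in> I \<Longrightarrow> proper (f i)" and "conjugate_split I f \<phi> a"
  shows "conjugate (\<lambda>x. \<Sum>i\<in>I. f i x) \<phi> \<le> ereal a"
proof -
  obtain w s where ws: "(\<Sum>i\<in>I. w i) = \<phi>" "(\<Sum>i\<in>I. s i) = a"
    "\<forall>i\<in>I. conjugate (f i) (w i) \<le> ereal (s i)"
    using assms(3) by (auto simp: conjugate_split_def)
  have "ereal (dual_apply \<phi> x - a) \<le> (\<Sum>i\<in>I. f i x)" for x
  proof -
    have "ereal (dual_apply \<phi> x - a) = (\<Sum>i\<in>I. ereal (dual_apply (w i) x - s i))"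
      using ws(1,2) by (auto simp: dual_apply_sum sum_subtractf)
    also have "\<dots> \<le> (\<Sum>i\<in>I. f i x)"
      using ws(3) f by (intro sum_mono) (simp add: proper_conjugate_le_iff)
    finally show ?thesis .
  qed
  moreover have "(\<Sum>i\<in>I. f i x) \<noteq> -\<infinity>" for x
    using f by (intro sum_ereal_not_MInf proper_not_MInf)
  ultimately show ?thesis by (simp add: conjugate_le_iff)
qed

lemma convex_conjugate_split:
  assumes f: "\<And>i. i \<in> I \<Longrightarrow> proper (f i)"
  shows "convex {(\<phi>, a). conjugate_split I f \<phi> a}"
proof (rule convexI, clarsimp)
  fix \<phi> a \<psi> b and u v :: real
  assume "conjugate_split I f \<phi> a" "conjugate_split I f \<psi> b" and uv: "0 \<le> u" "0 \<le> v" "u + v = 1"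
  then obtain w s w' s' where
    ws: "(\<Sum>i\<in>I. w i) = \<phi>" "(\<Sum>i\<in>I. s i) = a" "\<forall>i\<in>I. conjugate (f i) (w i) \<le> ereal (s i)" and
    ws': "(\<Sum>i\<in>I. w' i) = \<psi>" "(\<Sum>i\<in>I. s' i) = b" "\<forall>i\<in>I. conjugate (f i) (w' i) \<le> ereal (s' i)"
    unfolding conjugate_split_def by auto
  have "conjugate (f i) (u *\<^sub>R w i + v *\<^sub>R w' i) \<le> ereal (u * s i + v * s' i)" if i: "i \<in> I" for i
  proof -
    have "ereal (u * dual_apply (w i) x + v * dual_apply (w' i) x - (u * s i + v * s' i)) \<le> f i x" for x
    proof -
      have le: "ereal (dual_apply (w i) x - s i) \<le> f i x" "ereal (dual_apply (w' i) x - s' i) \<le> f i x"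
        using ws(3) ws'(3) i proper_conjugate_le_iff[OF f[OF i]] by auto
      show ?thesis
      proof (cases "f i x")
        case (real r)
        then have "u * (dual_apply (w i) x - s i) + v * (dual_apply (w' i) x - s' i) \<le> r"
          using le uv by (intro convex_bound_le) auto
        then show ?thesis using real by (simp add: algebra_simps)
      qed (use proper_not_MInf[OF f[OF i]] in auto)
    qed
    then show ?thesis
      by (simp add: proper_conjugate_le_iff[OF f[OF i]] plus_dual.rep_eq scaleR_dual.rep_eq)
  qed
  moreover have "(\<Sum>i\<in>I. u *\<^sub>R w i + v *\<^sub>R w' i) = u *\<^sub>R \<phi> + v *\<^sub>R \<psi>"
    "(\<Sum>i\<in>I. u * s i + v * s' i) = u * a + v * b"
    using ws(1,2) ws'(1,2) by (auto simp: sum.distrib scaleR_sum_right sum_distrib_left)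
  ultimately show "conjugate_split I f (u *\<^sub>R \<phi> + v *\<^sub>R \<psi>) (u * a + v * b)"
    unfolding conjugate_split_def by blast
qed

section \<open>Sums of \<epsilon>-subdifferentials as splittings\<close>

lemma sum_eps_subdiff_imp_split:
  assumes I: "finite I" and f: "\<And>i. i \<in> I \<Longrightarrow> proper (f i)"
    and F: "\<And>i. i \<in> I \<Longrightarrow> f i x = ereal (F i)"
    and \<phi>: "\<phi> \<in> (\<Sum>i\<in>I. eps_subdiff (e i) (f i) x)"
  shows "conjugate_split I f \<phi> (dual_apply \<phi> x - (\<Sum>i\<in>I. F i) + (\<Sum>i\<in>I. e i))"
proof -
  obtain w where w: "\<phi> = (\<Sum>i\<in>I. w i)" "\<forall>i\<in>I. w i \<in> eps_subdiff (e i) (f i) x"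
    using \<phi> by (auto simp: set_sum_alt[OF I])
  have "conjugate (f i) (w i) \<le> ereal (dual_apply (w i) x - F i + e i)" if "i \<in> I" for i
    using w(2) that eps_subdiff_iff[OF f[OF that], OF F[OF that]] by blast
  moreover have "(\<Sum>i\<in>I. dual_apply (w i) x - F i + e i)
      = dual_apply \<phi> x - (\<Sum>i\<in>I. F i) + (\<Sum>i\<in>I. e i)"
    by (simp add: w(1) dual_apply_sum sum_subtractf sum.distrib)
  ultimately show ?thesis unfolding conjugate_split_def w(1)
    by (intro exI[of _ w] exI[of _ "\<lambda>i. dual_apply (w i) x - F i + e i"]) auto
qed

lemma split_imp_sum_eps_subdiff:
  assumes I: "finite I" and f: "\<And>i. i \<in> I \<Longrightarrow> proper (f i)"
    and F: "\<And>i. i \<in> I \<Longrightarrow> f i x = ereal (F i)"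
    and \<phi>: "conjugate_split I f \<phi> (dual_apply \<phi> x - (\<Sum>i\<in>I. F i) + \<delta>)"
  obtains e where "\<And>i. i \<in> I \<Longrightarrow> 0 \<le> e i" "(\<Sum>i\<in>I. e i) = \<delta>"
    "\<phi> \<in> (\<Sum>i\<in>I. eps_subdiff (e i) (f i) x)"
proof -
  obtain w s where w: "(\<Sum>i\<in>I. w i) = \<phi>" "(\<Sum>i\<in>I. s i) = dual_apply \<phi> x - (\<Sum>i\<in>I. F i) + \<delta>"
    "\<forall>i\<in>I. conjugate (f i) (w i) \<le> ereal (s i)"
    using \<phi> by (auto simp: conjugate_split_def)
  \<comment> \<open>The Fenchel--Young gap of \<open>w i\<close> at \<open>x\<close>, measured with
    the bound \<open>s i\<close>. The gaps are nonnegative and add up to \<delta>.\<close>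
  define e where "e i = s i + F i - dual_apply (w i) x" for i
  have "0 \<le> e i" if "i \<in> I" for i
  proof -
    have "ereal (dual_apply (w i) x - s i) \<le> f i x"
      using w(3) that proper_conjugate_le_iff[OF f[OF that]] by blast
    then show ?thesis using F[OF that] by (simp add: e_def)
  qed
  moreover have "(\<Sum>i\<in>I. e i) = \<delta>"
    using w(2) by (simp add: e_def sum.distrib sum_subtractf dual_apply_sum flip: w(1))
  moreover have "w i \<in> eps_subdiff (e i) (f i) x" if "i \<in> I" for i
    using w(3) that eps_subdiff_iff[OF f[OF that], OF F[OF that]] by (simp add: e_def)
  then have "\<phi> \<in> (\<Sum>i\<in>I. eps_subdiff (e i) (f i) x)"
    using w(1) by (auto simp: set_sum_alt[OF I])
  ultimately show thesis using that by blast
qed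

text \<open>The individual parameters are nonnegative with sum \<delta>, so each is at most
  \<delta>.\<close>

lemma split_imp_sum_eps_subdiff_uniform:
  assumes I: "finite I" and f: "\<And>i. i \<in> I \<Longrightarrow> proper (f i)"
    and F: "\<And>i. i \<in> I \<Longrightarrow> f i x = ereal (F i)"
    and \<phi>: "conjugate_split I f \<phi> (dual_apply \<phi> x - (\<Sum>i\<in>I. F i) + \<delta>)"
  shows "\<phi> \<in> (\<Sum>i\<in>I. eps_subdiff \<delta> (f i) x)"
proof -
  obtain e where e: "\<And>i. i \<in> I \<Longrightarrow> 0 \<le> e i" "(\<Sum>i\<in>I. e i) = \<delta>"
    "\<phi> \<in> (\<Sum>i\<in>I. eps_subdiff (e i) (f i) x)"
    using split_imp_sum_eps_subdiff[of I f x F \<phi> \<delta>] assms by blast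
  have "e i \<le> \<delta>" if "i \<in> I" for i
    using member_le_sum[OF that, of e] e(1,2) I by auto
  then have "eps_subdiff (e i) (f i) x \<subseteq> eps_subdiff \<delta> (f i) x" if "i \<in> I" for i
    using that by (intro eps_subdiff_mono)
  then show ?thesis using e(3) unfolding set_sum_alt[OF I] by blast
qed

text \<open>Biconjugation on the weak* dual: there the conjugate of the infimal convolution is the sum of
  the lower semicontinuous hulls, so the epigraph of the conjugate of the sum is the closure of the
  epigraph of the infimal convolution.\<close>

lemma conjugate_sum_approx:
  fixes f :: "'i \<Rightarrow> 'a::locally_convex_space \<Rightarrow> ereal"
  assumes I: "finite I"
    and f: "\<And>i. i \<in> I \<Longrightarrow> proper (f i)" "\<And>i. i \<in> I \<Longrightarrow> convex_fun (f i)"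
    and dom: "\<And>i. i \<in> I \<Longrightarrow> f i x\<^sub>0 < \<infinity>"
    and hull: "\<And>i x. i \<in> I \<Longrightarrow> (\<And>j. j \<in> I \<Longrightarrow> lsc_hull (f j) x < \<infinity>) \<Longrightarrow> lsc_hull (f i) x = f i x"
    and \<phi>: "conjugate (\<lambda>x. \<Sum>i\<in>I. f i x) \<phi> \<le> ereal a"
    and U: "open U" "\<phi> \<in> U" and \<delta>: "\<delta> > 0"
  obtains \<psi> b where "\<psi> \<in> U" "b \<le> a + \<delta>" "conjugate_split I f \<psi> b"
proof (rule ccontr)
  note found = that
  assume "\<not> thesis"
  \<comment> \<open>Failure of the approximation bounds the set of splittings below by a + \<delta>
    over \<open>U\<close>, the local bound that \<open>convex_local_bound_minorant\<close> asks
    for.\<close>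
  then have lower: "a + \<delta> \<le> b" if "conjugate_split I f \<psi> b" "\<psi> \<in> U" for \<psi> b
    using found[OF that(2) _ that(1)] by linarith
  have nm: "(\<Sum>i\<in>I. f i x) \<noteq> -\<infinity>" for x
    using f(1) by (intro sum_ereal_not_MInf proper_not_MInf)
  \<comment> \<open>\<open>x\<^sub>0\<close> lies in the domain of every hull, so the hulls agree
    with the functions there and are not \<open>-\<infinity>\<close>.\<close>
  have f_x\<^sub>0: "-\<infinity> < lsc_hull (f i) x\<^sub>0" if "i \<in> I" for i
    using hull[OF that, of x\<^sub>0] lsc_hull_le dom proper_not_MInf[OF f(1)[OF that]]
    by (metis ereal_MInfty_lessI le_less_trans)
  have hull_nm: "lsc_hull (f i) y \<noteq> -\<infinity>" if i: "i \<in> I" for i y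
  proof -
    obtain \<psi> c where "\<And>y. ereal (dual_apply \<psi> y + c) \<le> f i y"
      using lsc_hull_affine_minorant[OF f(2)[OF i] dom[OF i] f_x\<^sub>0[OF i]] by blast
    moreover have "lsc (\<lambda>y. ereal (dual_apply \<psi> y + c))"
      unfolding lsc_def
      by (intro allI open_Collect_less continuous_on_const continuous_on_ereal continuous_on_add
          dual_apply_continuous)
    ultimately have "ereal (dual_apply \<psi> y + c) \<le> lsc_hull (f i) y" by (rule lsc_hull_greatest[rotated])
    then show ?thesis by auto
  qed
  obtain r\<^sub>0 where r\<^sub>0: "(\<Sum>i\<in>I. f i x\<^sub>0) = ereal r\<^sub>0"
    using nm[of x\<^sub>0] dom I by (cases "\<Sum>i\<in>I. f i x\<^sub>0") (auto simp: sum_Pinfty)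
  \<comment> \<open>Evaluation at \<open>x\<^sub>0\<close> gives the global affine minorant of the
    splittings that the separation requires.\<close>
  obtain E :: "'a dual dual" where E: "\<And>\<psi>. dual_apply E \<psi> = dual_apply \<psi> x\<^sub>0"
    using dual_eval[of x\<^sub>0] by blast
  obtain L :: "'a dual dual" where
    L: "\<And>\<psi> b. (\<psi>, b) \<in> {(\<psi>, b). conjugate_split I f \<psi> b} \<Longrightarrow> a + \<delta> + dual_apply L (\<psi> - \<phi>) \<le> b"
  proof (rule convex_local_bound_minorant[of "{(\<psi>, b). conjugate_split I f \<psi> b}" E "- r\<^sub>0" U \<phi> "a + \<delta>"])
    show "convex {(\<psi>, b). conjugate_split I f \<psi> b}" using f(1) by (rule convex_conjugate_split)
    fix \<psi> b assume "(\<psi>, b) \<in> {(\<psi>, b). conjugate_split I f \<psi> b}"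
    then have "conjugate (\<lambda>x. \<Sum>i\<in>I. f i x) \<psi> \<le> ereal b"
      using conjugate_split_imp_conjugate_le[OF I f(1)] by auto
    then have "ereal (dual_apply \<psi> x\<^sub>0 - b) \<le> ereal r\<^sub>0"
      unfolding conjugate_le_iff[OF nm] r\<^sub>0[symmetric] by blast
    then show "dual_apply E \<psi> + - r\<^sub>0 \<le> b" by (simp add: E)
  qed (use U lower in auto)
  \<comment> \<open>The separating form on the weak* dual is a point of the original space, where
    the functions and their hulls can be compared.\<close>
  obtain y where y: "\<And>\<psi>. dual_apply L \<psi> = dual_apply \<psi> y" using weak_star_dual_eq_eval[of L] by blast
  \<comment> \<open>If all hulls are finite at \<open>y\<close>, the hypothesis identifies them with
    the functions; otherwise both sums are infinite.\<close>
  have sum_eq: "(\<Sum>i\<in>I. lsc_hull (f i) y) = (\<Sum>i\<in>I. f i y)"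
  proof (cases "\<forall>i\<in>I. lsc_hull (f i) y < \<infinity>")
    case True
    then show ?thesis using hull by (intro sum.cong) auto
  next
    case False
    then obtain j where j: "j \<in> I" "lsc_hull (f j) y = \<infinity>" by auto
    then have "f j y = \<infinity>" using lsc_hull_le[of "f j" y] by simp
    then show ?thesis using j I by (metis sum_Pinfty)
  qed
  have "ereal (dual_apply \<phi> y - a) \<le> (\<Sum>i\<in>I. f i y)"
    using \<phi> by (simp add: conjugate_le_iff[OF nm])
  then have "ereal (dual_apply \<phi> y - a - \<delta>) < (\<Sum>i\<in>I. lsc_hull (f i) y)"
    using \<delta> unfolding sum_eq by (elim less_le_trans[rotated]) simp
  then obtain r where r: "\<forall>i\<in>I. ereal (r i) < lsc_hull (f i) y" "dual_apply \<phi> y - a - \<delta> < (\<Sum>i\<in>I. r i)"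
    using less_sum_ereal_approx[of I "\<lambda>i. lsc_hull (f i) y"] I hull_nm by blast
  have "\<exists>\<psi> c. (\<forall>z. ereal (dual_apply \<psi> z + c) \<le> f i z) \<and> dual_apply \<psi> y + c = r i" if i: "i \<in> I" for i
    using fenchel_moreau[OF f(2)[OF i] dom[OF i] f_x\<^sub>0[OF i], of "r i" y] r(1) i by metis
  then obtain w c where w: "\<And>i z. i \<in> I \<Longrightarrow> ereal (dual_apply (w i) z + c i) \<le> f i z"
    "\<And>i. i \<in> I \<Longrightarrow> dual_apply (w i) y + c i = r i"
    by metis
  have "conjugate (f i) (w i) \<le> ereal (- c i)" if "i \<in> I" for i
    using w(1)[OF that] proper_conjugate_le_iff[OF f(1)[OF that], of "w i" "- c i"] by simp
  \<comment> \<open>Inserting this splitting in the bound from \<open>L\<close> makes the sum of the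
    \<open>r i\<close> at most \<open>dual_apply \<phi> y - a - \<delta>\<close>, contrary to the
    choice of \<open>r\<close>.\<close>
  then have "conjugate_split I f (\<Sum>i\<in>I. w i) (\<Sum>i\<in>I. - c i)"
    unfolding conjugate_split_def by (intro exI[of _ w] exI[of _ "\<lambda>i. - c i"]) auto
  then have "a + \<delta> + dual_apply ((\<Sum>i\<in>I. w i) - \<phi>) y \<le> (\<Sum>i\<in>I. - c i)"
    using L y by auto
  moreover have "(\<Sum>i\<in>I. r i) = (\<Sum>i\<in>I. dual_apply (w i) y) + (\<Sum>i\<in>I. c i)"
    using w(2) by (simp add: sum.distrib[symmetric])
  ultimately show False
    using r(2) by (simp add: minus_dual.rep_eq dual_apply_sum sum_negf)
qed

lemma conjugate_split_imp_inf_conv_le: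
  assumes "finite I" "I \<noteq> {}" "\<And>i. i \<in> I \<Longrightarrow> proper (f i)" "conjugate_split I f \<phi> a"
  shows "inf_conv I (\<lambda>i. conjugate (f i)) \<phi> \<le> ereal a"
  using assms by (auto simp: inf_conv_le_iff intro: conjugate_split_mono)

lemma conjugate_sum_le_inf_conv:
  assumes "finite I" "I \<noteq> {}" "\<And>i. i \<in> I \<Longrightarrow> proper (f i)"
  shows "conjugate (\<lambda>x. \<Sum>i\<in>I. f i x) \<phi> \<le> inf_conv I (\<lambda>i. conjugate (f i)) \<phi>"
proof (rule ereal_le_real)
  fix a assume a: "inf_conv I (\<lambda>i. conjugate (f i)) \<phi> \<le> ereal a"
  show "conjugate (\<lambda>x. \<Sum>i\<in>I. f i x) \<phi> \<le> ereal a"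
  proof (rule ereal_le_epsilon2)
    fix e :: real assume "e > 0"
    then have "conjugate_split I f \<phi> (a + e)" using a assms by (simp add: inf_conv_le_iff)
    then show "conjugate (\<lambda>x. \<Sum>i\<in>I. f i x) \<phi> \<le> ereal a + ereal e"
      using conjugate_split_imp_conjugate_le[of I f] assms by simp
  qed
qed

theorem theorem3p2:
  fixes f :: "nat \<Rightarrow> 'a::{locally_convex_space, t2_space} \<Rightarrow> ereal"
    and m :: nat
  assumes "1 \<le> m"
    and "\<And>i. i \<in> {1..m} \<Longrightarrow> proper (f i)"
    and "\<And>i. i \<in> {1..m} \<Longrightarrow> convex_fun (f i)"
    and "(\<Inter>i\<in>{1..m}. effective_dom (f i)) \<noteq> {}"
    and "\<And>i x. i \<in> {1..m} \<Longrightarrow> x \<in> (\<Inter>j\<in>{1..m}. effective_dom (lsc_hull (f j))) \<Longrightarrow>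
           lsc_hull (f i) x = f i x"
  shows
    "((\<exists>K>0. \<forall>x\<in>(\<Inter>i\<in>{1..m}. effective_dom (f i)). \<forall>\<epsilon>>0.
         closure (\<Sum>i\<in>{1..m}. eps_subdiff \<epsilon> (f i) x)
           \<subseteq> (\<Sum>i\<in>{1..m}. eps_subdiff (K * \<epsilon>) (f i) x))
       \<longleftrightarrow>
      conjugate (\<lambda>x. \<Sum>i\<in>{1..m}. f i x) = inf_conv {1..m} (\<lambda>i. conjugate (f i)))
     \<and>
     (conjugate (\<lambda>x. \<Sum>i\<in>{1..m}. f i x) = inf_conv {1..m} (\<lambda>i. conjugate (f i))
       \<longleftrightarrow>
      lsc (inf_conv {1..m} (\<lambda>i. conjugate (f i))))
     \<and>
     (lsc (inf_conv {1..m} (\<lambda>i. conjugate (f i)))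
       \<longleftrightarrow>
      (\<forall>x. \<forall>\<epsilon>\<ge>0.
         eps_subdiff \<epsilon> (\<lambda>x. \<Sum>i\<in>{1..m}. f i x) x =
           (\<Inter>\<eta>\<in>{0<..}. \<Union>e\<in>{e. (\<forall>i\<in>{1..m}. 0 \<le> e i) \<and> (\<Sum>i\<in>{1..m}. e i) = \<epsilon> + \<eta>}.
              \<Sum>i\<in>{1..m}. eps_subdiff (e i) (f i) x)))"
proof -

  \<comment> \<open>Notation and the common reformulation as duality\<close>
  define I where "I = {1..m}"
  have I: "finite I" "I \<noteq> {}" "card I = m" using assms(1) by (auto simp: I_def)
  define g where "g = (\<lambda>x. \<Sum>i\<in>I. f i x)"
  define h where "h = inf_conv I (\<lambda>i. conjugate (f i))"
  have f: "proper (f i)" "convex_fun (f i)" if "i \<in> I" for i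
    using assms(2,3) that by (auto simp: I_def)
  have dom_iff: "x \<in> (\<Inter>i\<in>I. effective_dom (f i)) \<longleftrightarrow> (\<forall>i\<in>I. f i x < \<infinity>)" for x
    by (auto simp: effective_dom_def)
  obtain x\<^sub>0 where x\<^sub>0: "\<And>i. i \<in> I \<Longrightarrow> f i x\<^sub>0 < \<infinity>"
    using assms(4) dom_iff unfolding I_def[symmetric] by blast
  have hull: "lsc_hull (f i) x = f i x" if "i \<in> I" "\<And>j. j \<in> I \<Longrightarrow> lsc_hull (f j) x < \<infinity>" for i x
    using assms(5) that by (auto simp: effective_dom_def I_def)
  have g_dom: "g x < \<infinity> \<longleftrightarrow> (\<forall>i\<in>I. f i x < \<infinity>)" for x
    using I(1) by (auto simp: g_def sum_Pinfty less_top[symmetric] top_ereal_def)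
  have g: "proper g"
    unfolding proper_def
  proof (intro conjI allI)
    show "effective_dom g \<noteq> {}" using x\<^sub>0 g_dom by (auto simp: effective_dom_def)
    fix x
    have "g x \<noteq> -\<infinity>" unfolding g_def using f(1) by (intro sum_ereal_not_MInf proper_not_MInf)
    then show "-\<infinity> < g x" by simp
  qed
  have finite_values: "\<exists>F. \<forall>i\<in>I. f i x = ereal (F i)" if "\<forall>i\<in>I. f i x < \<infinity>" for x
  proof -
    have "f i x = ereal (real_of_ereal (f i x))" if "i \<in> I" for i
      using proper_not_MInf[OF f(1)[OF that], of x] \<open>\<forall>i\<in>I. f i x < \<infinity>\<close> that
      by (auto simp: ereal_real)
    then show ?thesis by (intro exI[of _ "\<lambda>i. real_of_ereal (f i x)"]) blast
  qed
  have g_value: "g x = ereal (\<Sum>i\<in>I. F i)" if "\<forall>i\<in>I. f i x = ereal (F i)" for x F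
    using that by (simp add: g_def)
  have h_le_iff: "h \<phi> \<le> ereal a \<longleftrightarrow> (\<forall>\<eta>>0. conjugate_split I f \<phi> (a + \<eta>))" for \<phi> a
    using inf_conv_le_iff[of I f] I f(1) by (simp add: h_def)
  have split_imp: "h \<phi> \<le> ereal a" "conjugate g \<phi> \<le> ereal a"
    if "conjugate_split I f \<phi> a" for \<phi> a
    using conjugate_split_imp_inf_conv_le[OF I(1,2) f(1) that]
      conjugate_split_imp_conjugate_le[OF I(1) f(1) that]
    by (simp_all add: h_def g_def)
  have approx: "\<exists>\<psi>\<in>U. conjugate_split I f \<psi> (a + \<delta>)"
    if le: "conjugate g \<phi> \<le> ereal a" "open U" "\<phi> \<in> U" "\<delta> > 0" for \<phi> a U \<delta>
  proof -
    obtain \<psi> b where "\<psi> \<in> U" "b \<le> a + \<delta>" "conjugate_split I f \<psi> b"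
      using conjugate_sum_approx[OF I(1) f x\<^sub>0 hull le[unfolded g_def]] by blast
    then show ?thesis using conjugate_split_mono[OF I(1,2)] by blast
  qed
  \<comment> \<open>This is \<open>h \<le> conjugate g\<close>, phrased through real bounds. The
    reverse inequality always holds, so each condition is compared with this one.\<close>
  define duality where "duality \<longleftrightarrow> (\<forall>\<phi> a. conjugate g \<phi> \<le> ereal a \<longrightarrow> h \<phi> \<le> ereal a)"
  have ii: "conjugate g = h \<longleftrightarrow> duality"
  proof
    assume duality
    then have "h \<phi> \<le> conjugate g \<phi>" for \<phi> by (auto simp: duality_def intro: ereal_le_real)
    moreover have "conjugate g \<phi> \<le> h \<phi>" for \<phi>
      using conjugate_sum_le_inf_conv[OF I(1,2) f(1)] by (simp add: g_def h_def)
    ultimately show "conjugate g = h" by (auto intro: antisym)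
  qed (simp add: duality_def)

  \<comment> \<open>Condition (i): closures of sums of subdifferentials\<close>
  have i: "(\<exists>K>0. \<forall>x\<in>(\<Inter>i\<in>I. effective_dom (f i)). \<forall>\<epsilon>>0.
      closure (\<Sum>i\<in>I. eps_subdiff \<epsilon> (f i) x) \<subseteq> (\<Sum>i\<in>I. eps_subdiff (K * \<epsilon>) (f i) x))
      \<longleftrightarrow> duality"
  proof
    assume "\<exists>K>0. \<forall>x\<in>(\<Inter>i\<in>I. effective_dom (f i)). \<forall>\<epsilon>>0.
      closure (\<Sum>i\<in>I. eps_subdiff \<epsilon> (f i) x) \<subseteq> (\<Sum>i\<in>I. eps_subdiff (K * \<epsilon>) (f i) x)"
    then obtain K where K: "K > 0"
      "\<And>x \<epsilon>. (\<forall>i\<in>I. f i x < \<infinity>) \<Longrightarrow> \<epsilon> > 0 \<Longrightarrow>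
        closure (\<Sum>i\<in>I. eps_subdiff \<epsilon> (f i) x) \<subseteq> (\<Sum>i\<in>I. eps_subdiff (K * \<epsilon>) (f i) x)"
      unfolding dom_iff[symmetric] by blast
    show duality unfolding duality_def
    proof (intro allI impI)
      fix \<phi> a assume "conjugate g \<phi> \<le> ereal a"
      \<comment> \<open>The exact value \<open>c\<close>, unlike the bound \<open>a\<close>, admits
        a nearly maximising point \<open>x\<close>.\<close>
      then obtain c where c: "conjugate g \<phi> = ereal c" "c \<le> a"
        using proper_conjugate_not_MInf[OF g, of \<phi>] by (cases "conjugate g \<phi>") auto
      have "h \<phi> \<le> ereal c"
      proof (rule ereal_le_epsilon2)
        fix e :: real assume e: "e > 0"
        \<comment> \<open>Chosen so that m terms K (3 \<epsilon>) add up to \<open>e\<close>. The 3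
          collects one \<epsilon> each for the choice of \<open>x\<close>, for the closeness of
          \<psi> to \<phi> at \<open>x\<close>, and for the approximate bound c +
          \<epsilon>.\<close>
        define \<epsilon> where "\<epsilon> = e / (3 * K * m)"
        have \<epsilon>: "\<epsilon> > 0" "m * (K * (3 * \<epsilon>)) = e"
          using e K(1) assms(1) by (auto simp: \<epsilon>_def)
        have "ereal (c - \<epsilon>) < conjugate g \<phi>" using c \<epsilon> by simp
        then obtain x where x: "ereal (c - \<epsilon>) < ereal (dual_apply \<phi> x) - g x"
          by (auto simp: conjugate_def less_SUP_iff)
        then have dom: "\<forall>i\<in>I. f i x < \<infinity>" unfolding g_dom[symmetric] by (cases "g x") auto
        then obtain F where F: "\<forall>i\<in>I. f i x = ereal (F i)" using finite_values by blast
        define G where "G = (\<Sum>i\<in>I. F i)"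
        have gx: "g x = ereal G" using g_value[OF F] by (simp add: G_def)
        have near: "c < dual_apply \<phi> x - G + \<epsilon>" using x gx by simp
        have "ereal (dual_apply \<phi> x - c) \<le> g x"
          using c proper_conjugate_le_iff[OF g, of \<phi> c] by simp
        then have Gc: "dual_apply \<phi> x - G \<le> c" using gx by simp
        have "\<phi> \<in> closure (\<Sum>i\<in>I. eps_subdiff (3 * \<epsilon>) (f i) x)" (is "_ \<in> closure ?S")
        proof (rule ccontr)
          assume "\<phi> \<notin> closure ?S"
          \<comment> \<open>The second set controls \<psi> at \<open>x\<close>. Any approximating
            \<psi> in this neighbourhood lies in the sum of the subdifferentials, although the first
            set excludes it.\<close>
          then have "\<phi> \<in> - closure ?S \<inter> {\<psi>. dual_apply \<phi> x - \<epsilon> < dual_apply \<psi> x}" using \<epsilon> by simp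
          moreover have "open (- closure ?S \<inter> {\<psi>. dual_apply \<phi> x - \<epsilon> < dual_apply \<psi> x})"
            by (intro open_Int open_Compl closed_closure open_Collect_less
                continuous_on_const continuous_on_dual_apply)
          ultimately obtain \<psi> where \<psi>: "\<psi> \<notin> closure ?S" "dual_apply \<phi> x - \<epsilon> < dual_apply \<psi> x"
            "conjugate_split I f \<psi> (c + \<epsilon>)"
            using approx[of \<phi> c "- closure ?S \<inter> {\<psi>. dual_apply \<phi> x - \<epsilon> < dual_apply \<psi> x}" \<epsilon>] c \<epsilon>(1)
            by auto
          have "conjugate_split I f \<psi> (dual_apply \<psi> x - (\<Sum>i\<in>I. F i) + 3 * \<epsilon>)"
            using \<psi>(2) near by (intro conjugate_split_mono[OF I(1,2) \<psi>(3)]) (simp add: G_def)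
          then have "\<psi> \<in> ?S"
            using split_imp_sum_eps_subdiff_uniform[of I f x F \<psi>] I(1) f(1) F by blast
          then show False using \<psi>(1) closure_subset by blast
        qed
        then have "\<phi> \<in> (\<Sum>i\<in>I. eps_subdiff (K * (3 * \<epsilon>)) (f i) x)"
          using K(2)[OF dom, of "3 * \<epsilon>"] \<epsilon>(1) by auto
        then have "conjugate_split I f \<phi> (dual_apply \<phi> x - (\<Sum>i\<in>I. F i) + (\<Sum>i\<in>I. K * (3 * \<epsilon>)))"
          using sum_eps_subdiff_imp_split[of I f x F \<phi> "\<lambda>_. K * (3 * \<epsilon>)"] I(1) f(1) F by blast
        then have "conjugate_split I f \<phi> (dual_apply \<phi> x - G + e)" using \<epsilon>(2) I(3) by (simp add: G_def)
        then have "conjugate_split I f \<phi> (c + e)"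
          by (rule conjugate_split_mono[OF I(1,2)]) (use Gc in simp)
        then show "h \<phi> \<le> ereal c + ereal e" using split_imp(1) by simp
      qed
      then show "h \<phi> \<le> ereal a" using c(2) by (auto elim: order_trans)
    qed
  next
    assume duality: duality
    show "\<exists>K>0. \<forall>x\<in>(\<Inter>i\<in>I. effective_dom (f i)). \<forall>\<epsilon>>0.
      closure (\<Sum>i\<in>I. eps_subdiff \<epsilon> (f i) x) \<subseteq> (\<Sum>i\<in>I. eps_subdiff (K * \<epsilon>) (f i) x)"
    \<comment> \<open>Of K = m + 1, the part m comes from adding m subdifferentials with parameter
      \<epsilon>, and the 1 from the slack needed to pass from a bound on \<open>h\<close> to a
      splitting.\<close>
    proof (intro exI[of _ "real m + 1"] conjI ballI allI impI subsetI)
      fix x and \<epsilon> :: real and \<phi>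
      assume x: "x \<in> (\<Inter>i\<in>I. effective_dom (f i))" and \<epsilon>: "\<epsilon> > 0"
        and \<phi>: "\<phi> \<in> closure (\<Sum>i\<in>I. eps_subdiff \<epsilon> (f i) x)"
      obtain F where F: "\<forall>i\<in>I. f i x = ereal (F i)" using x finite_values unfolding dom_iff by blast
      have "(\<Sum>i\<in>I. eps_subdiff \<epsilon> (f i) x) \<subseteq> eps_subdiff (m * \<epsilon>) g x"
      proof
        fix \<psi> assume "\<psi> \<in> (\<Sum>i\<in>I. eps_subdiff \<epsilon> (f i) x)"
        then have "conjugate_split I f \<psi> (dual_apply \<psi> x - (\<Sum>i\<in>I. F i) + (\<Sum>i\<in>I. \<epsilon>))"
          using sum_eps_subdiff_imp_split[of I f x F \<psi> "\<lambda>_. \<epsilon>"] I(1) f(1) F by blast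
        then show "\<psi> \<in> eps_subdiff (m * \<epsilon>) g x"
          using split_imp(2) I(3) by (simp add: eps_subdiff_iff[OF g g_value[OF F]])
      qed
      then have "\<phi> \<in> eps_subdiff (m * \<epsilon>) g x"
        using \<phi> closure_minimal[OF _ closed_eps_subdiff] by blast
      then have "h \<phi> \<le> ereal (dual_apply \<phi> x - (\<Sum>i\<in>I. F i) + m * \<epsilon>)"
        using duality by (simp add: eps_subdiff_iff[OF g g_value[OF F]] duality_def)
      then have "conjugate_split I f \<phi> (dual_apply \<phi> x - (\<Sum>i\<in>I. F i) + m * \<epsilon> + \<epsilon>)"
        using \<epsilon> by (simp add: h_le_iff)
      then have "conjugate_split I f \<phi> (dual_apply \<phi> x - (\<Sum>i\<in>I. F i) + (real m + 1) * \<epsilon>)"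
        by (simp add: algebra_simps)
      then show "\<phi> \<in> (\<Sum>i\<in>I. eps_subdiff ((real m + 1) * \<epsilon>) (f i) x)"
        using split_imp_sum_eps_subdiff_uniform[of I f x F \<phi>] I(1) f(1) F by blast
    qed simp
  qed

  \<comment> \<open>Condition (iii): weak* lower semicontinuity\<close>
  have iii: "lsc h \<longleftrightarrow> duality"
  proof
    assume duality
    then have "h = conjugate g" using ii by simp
    then show "lsc h" using lsc_conjugate[of g] proper_not_MInf[OF g] by simp
  next
    assume lsc: "lsc h"
    show duality unfolding duality_def
    proof (intro allI impI, rule ccontr)
      fix \<phi> a assume *: "conjugate g \<phi> \<le> ereal a" "\<not> h \<phi> \<le> ereal a"
      then obtain b where b: "ereal a < ereal b" "ereal b < h \<phi>" using ereal_dense2 not_le by metis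
      \<comment> \<open>Lower semicontinuity makes \<open>{\<psi>. ereal b < h \<psi>}\<close> a
        neighbourhood of \<phi>, so the approximation yields a splitting with value \<open>b\<close>
        inside it.\<close>
      then obtain \<psi> where "ereal b < h \<psi>" "conjugate_split I f \<psi> b"
        using approx[OF *(1), of "{\<psi>. ereal b < h \<psi>}" "b - a"] lsc by (auto simp: lsc_def)
      then show False using split_imp(1) by (auto simp: not_le[symmetric])
    qed
  qed

  \<comment> \<open>Condition (iv): the subdifferential formula\<close>
  have iv: "(\<forall>x. \<forall>\<epsilon>\<ge>0. eps_subdiff \<epsilon> g x =
      (\<Inter>\<eta>\<in>{0<..}. \<Union>e\<in>{e. (\<forall>i\<in>I. 0 \<le> e i) \<and> (\<Sum>i\<in>I. e i) = \<epsilon> + \<eta>}.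
         \<Sum>i\<in>I. eps_subdiff (e i) (f i) x)) \<longleftrightarrow> duality"
    (is "(\<forall>x. \<forall>\<epsilon>\<ge>0. _ = ?R x \<epsilon>) \<longleftrightarrow> _")
  proof -
    have R_iff: "\<phi> \<in> ?R x \<epsilon> \<longleftrightarrow> h \<phi> \<le> ereal (dual_apply \<phi> x - (\<Sum>i\<in>I. F i) + \<epsilon>)"
      if F: "\<forall>i\<in>I. f i x = ereal (F i)" for \<phi> x \<epsilon> F
    proof -
      have "(\<exists>e. (\<forall>i\<in>I. 0 \<le> e i) \<and> (\<Sum>i\<in>I. e i) = \<delta> \<and> \<phi> \<in> (\<Sum>i\<in>I. eps_subdiff (e i) (f i) x))
          \<longleftrightarrow> conjugate_split I f \<phi> (dual_apply \<phi> x - (\<Sum>i\<in>I. F i) + \<delta>)" for \<delta>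
      proof
        assume "conjugate_split I f \<phi> (dual_apply \<phi> x - (\<Sum>i\<in>I. F i) + \<delta>)"
        then obtain e where "\<And>i. i \<in> I \<Longrightarrow> 0 \<le> e i" "(\<Sum>i\<in>I. e i) = \<delta>"
          "\<phi> \<in> (\<Sum>i\<in>I. eps_subdiff (e i) (f i) x)"
          using split_imp_sum_eps_subdiff[of I f x F \<phi> \<delta>] I(1) f(1) F by blast
        then show "\<exists>e. (\<forall>i\<in>I. 0 \<le> e i) \<and> (\<Sum>i\<in>I. e i) = \<delta> \<and> \<phi> \<in> (\<Sum>i\<in>I. eps_subdiff (e i) (f i) x)"
          by blast
      next
        assume "\<exists>e. (\<forall>i\<in>I. 0 \<le> e i) \<and> (\<Sum>i\<in>I. e i) = \<delta> \<and> \<phi> \<in> (\<Sum>i\<in>I. eps_subdiff (e i) (f i) x)"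
        then obtain e where "(\<Sum>i\<in>I. e i) = \<delta>" "\<phi> \<in> (\<Sum>i\<in>I. eps_subdiff (e i) (f i) x)" by blast
        then show "conjugate_split I f \<phi> (dual_apply \<phi> x - (\<Sum>i\<in>I. F i) + \<delta>)"
          using sum_eps_subdiff_imp_split[of I f x F \<phi> e] I(1) f(1) F by blast
      qed
      then show ?thesis by (simp add: h_le_iff Bex_def add.assoc conj_assoc) (simp add: Ball_def)
    qed
    show ?thesis
    proof
      assume *: "\<forall>x. \<forall>\<epsilon>\<ge>0. eps_subdiff \<epsilon> g x = ?R x \<epsilon>"
      obtain F where F: "\<forall>i\<in>I. f i x\<^sub>0 = ereal (F i)" using x\<^sub>0 finite_values by blast
      show duality unfolding duality_def
      proof (intro allI impI)
        fix \<phi> a assume a: "conjugate g \<phi> \<le> ereal a"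
        \<comment> \<open>With this choice the bound in \<open>R_iff\<close> at
          \<open>x\<^sub>0\<close> is exactly \<open>a\<close>, so the formula at one point of the
          common domain yields duality for all \<phi> and \<open>a\<close>.\<close>
        define \<epsilon> where "\<epsilon> = a - (dual_apply \<phi> x\<^sub>0 - (\<Sum>i\<in>I. F i))"
        have "ereal (dual_apply \<phi> x\<^sub>0 - a) \<le> g x\<^sub>0" using a proper_conjugate_le_iff[OF g] by blast
        then have "\<epsilon> \<ge> 0" by (simp add: g_value[OF F] \<epsilon>_def)
        moreover have "\<phi> \<in> eps_subdiff \<epsilon> g x\<^sub>0"
          using a by (simp add: eps_subdiff_iff[OF g g_value[OF F]] \<epsilon>_def)
        ultimately have "\<phi> \<in> ?R x\<^sub>0 \<epsilon>" using * by blast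
        then show "h \<phi> \<le> ereal a" unfolding R_iff[OF F] by (simp add: \<epsilon>_def)
      qed
    next
      assume duality: duality
      show "\<forall>x. \<forall>\<epsilon>\<ge>0. eps_subdiff \<epsilon> g x = ?R x \<epsilon>"
      proof (intro allI impI)
        fix x and \<epsilon> :: real
        show "eps_subdiff \<epsilon> g x = ?R x \<epsilon>"
        proof (cases "\<forall>i\<in>I. f i x < \<infinity>")
          case True
          then obtain F where F: "\<forall>i\<in>I. f i x = ereal (F i)" using finite_values by blast
          have "conjugate g = h" using duality ii by simp
          then have "\<phi> \<in> eps_subdiff \<epsilon> g x \<longleftrightarrow> \<phi> \<in> ?R x \<epsilon>" for \<phi>
            unfolding R_iff[OF F] eps_subdiff_iff[OF g g_value[OF F]] by simp
          then show ?thesis by blast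
        next
          case False
          then obtain j where j: "j \<in> I" "f j x = \<infinity>" by auto
          have "\<not> g x < \<infinity>" using False g_dom by blast
          then have "g x = \<infinity>" by simp
          then have "eps_subdiff \<epsilon> g x = {}" by (simp add: eps_subdiff_def)
          moreover have "eps_subdiff \<delta> (f j) x = {}" for \<delta> using j(2) by (simp add: eps_subdiff_def)
          then have "(\<Sum>i\<in>I. eps_subdiff (e i) (f i) x) = {}" for e
            unfolding set_sum_alt[OF I(1)] using j(1) by blast
          \<comment> \<open>The member \<eta> = 1 of the intersection is already empty.\<close>
          then have "?R x \<epsilon> = {}" by (auto intro: exI[of _ "1::real"])
          ultimately show ?thesis by simp
        qed
      qed
    qed
  qed
  show ?thesis
    using i ii iii iv unfolding I_def g_def h_def by blast
qed

end
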